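(* Let $(\mathfrak{M},\Phi,\xi,\eta,g)$ be a Kenmotsu manifold of odd dimension $2n+1$ with scalar curvature $r$. Suppose that $g$ satisfies a $\ast$-Ricci-Bourguignon soliton $(g,\varrho,\Omega,\omega)$ with real constants $\Omega,\omega$, whose potential vector field $\varrho$ is torse-forming, i.e. $\nabla_{\mathbb{Y}}\varrho=\Psi\,\mathbb{Y}+\gamma(\mathbb{Y})\varrho$ for all vector fields $\mathbb{Y}$, with $\Psi$ a smooth function and $\gamma$ a 1-form. Then $$\Omega=\frac{\gamma(\varrho)+r+1}{2n+1}+\Psi+(2n-1)-\omega(r+4n^2),$$ and the soliton is compressing, balancing or enlarging according as $$\frac{\gamma(\varrho)+r+1}{2n+1}+\Psi+(2n-1)-\omega(r+4n^2)$$ is $>0$, $=0$ or $<0$, respectively.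
   Context: An almost contact metric manifold of dimension $2n+1$ is a manifold $\mathfrak{M}$ with a $(1,1)$-tensor field $\Phi$, a vector field $\xi$, a 1-form $\eta$ and a Riemannian metric $g$ such that $\Phi^2\mathbb{Y}=-\mathbb{Y}+\eta(\mathbb{Y})\xi$, $\eta\circ\Phi=0$, $\Phi\xi=0$, $\eta(\xi)=1$, $g(\Phi \mathbb{Y}_1,\Phi \mathbb{Y}_2)=g(\mathbb{Y}_1,\mathbb{Y}_2)-\eta(\mathbb{Y}_1)\eta(\mathbb{Y}_2)$, $g(\mathbb{Y}_1,\Phi \mathbb{Y}_2)=-g(\Phi \mathbb{Y}_1,\mathbb{Y}_2)$, $g(\mathbb{Y},\xi)=\eta(\mathbb{Y})$. It is a Kenmotsu manifold if, with $\nabla$ the Levi-Civita connection of $g$, $(\nabla_{\mathbb{Y}_1}\Phi)\mathbb{Y}_2=-g(\mathbb{Y}_1,\Phi \mathbb{Y}_2)\xi-\eta(\mathbb{Y}_2)\Phi \mathbb{Y}_1$ and $\nabla_{\mathbb{Y}_1}\xi=\mathbb{Y}_1-\eta(\mathbb{Y}_1)\xi$. The $\ast$-Ricci tensor is $\mathbb{S}^\ast(\mathbb{Y}_1,\mathbb{Y}_2)=\tfrac12\mathrm{Tr}\big(\Phi\circ R(\mathbb{Y}_1,\Phi \mathbb{Y}_2)\big)$, where $R$ is the Riemann curvature tensor, with sign convention such that $R(\mathbb{Y}_1,\mathbb{Y}_2)\xi=\eta(\mathbb{Y}_1)\mathbb{Y}_2-\eta(\mathbb{Y}_2)\mathbb{Y}_1$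 on a Kenmotsu manifold; $r^\ast=\mathrm{Tr}(\mathbb{S}^\ast)$ is the $\ast$-scalar curvature. On a $(2n+1)$-dimensional Kenmotsu manifold with Ricci tensor $\mathbb{S}$ it is known (and used as given) that $\mathbb{S}^\ast(\mathbb{Y}_1,\mathbb{Y}_2)=\mathbb{S}(\mathbb{Y}_1,\mathbb{Y}_2)+(2n-1)g(\mathbb{Y}_1,\mathbb{Y}_2)+\eta(\mathbb{Y}_1)\eta(\mathbb{Y}_2)$, hence $r^\ast=r+4n^2$. A $\ast$-Ricci-Bourguignon soliton $(g,z,\Omega,\omega)$ means that $\mathscr{L}_z g+2\mathbb{S}^\ast=2[\Omega+\omega r^\ast]g$, where $\mathscr{L}_z$ is the Lie derivative along $z$ and $\Omega,\omega\in\mathbb{R}$ are constants. The soliton is called compressing if $\Omega>0$, balancing if $\Omega=0$, and enlarging if $\Omega<0$. In the paper's definition a torse-forming vector field is taken to be non-vanishing. *)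

theory Defs
  imports "HOL-Analysis.Analysis" "HOL-Library.Function_Algebras"
begin

section \<open>Smooth manifolds\<close>

fun Ck_on :: "nat \<Rightarrow> 'a::euclidean_space set \<Rightarrow> ('a \<Rightarrow> 'b::real_normed_vector) \<Rightarrow> bool" where
  "Ck_on 0 S f \<longleftrightarrow> continuous_on S f"
| "Ck_on (Suc k) S f \<longleftrightarrow>
     (\<forall>x\<in>S. f differentiable (at x)) \<and> (\<forall>v. Ck_on k S (\<lambda>x. frechet_derivative f (at x) v))"

text \<open>Only used for open \<open>S\<close>; the values of \<open>f\<close> outside \<open>S\<close> are then irrelevant.\<close>

definition smooth_on :: "'a::euclidean_space set \<Rightarrow> ('a \<Rightarrow> 'b::real_normed_vector) \<Rightarrow> bool" where
  "smooth_on S f \<longleftrightarrow> (\<forall>k. Ck_on k S f)"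

type_synonym ('m, 'e) chart = "'m set \<times> ('m \<Rightarrow> 'e)"

text \<open>The underlying space of the manifold is the whole type \<open>'m\<close>; the Hausdorff property and second
  countability are imposed through its sort. The dimension is \<open>DIM('e)\<close>. The atlas is not required
  to be maximal.\<close>

definition smooth_atlas :: "('m::topological_space, 'e::euclidean_space) chart set \<Rightarrow> bool" where
  "smooth_atlas A \<longleftrightarrow>
     (\<Union>(U, \<phi>)\<in>A. U) = UNIV \<and>
     (\<forall>(U, \<phi>)\<in>A. open U \<and> open (\<phi> ` U) \<and> homeomorphism U (\<phi> ` U) \<phi> (inv_into U \<phi>)) \<and>
     (\<forall>(U, \<phi>)\<in>A. \<forall>(V, \<psi>)\<in>A. smooth_on (\<phi> ` (U \<inter> V)) (\<psi> \<circ> inv_into U \<phi>))"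

definition smooth_functions ::
    "('m, 'e::euclidean_space) chart set \<Rightarrow> ('m \<Rightarrow> real) set" where
  "smooth_functions A = {f. \<forall>(U, \<phi>)\<in>A. smooth_on (\<phi> ` U) (f \<circ> inv_into U \<phi>)}"

section \<open>Vector fields and tensor fields\<close>

text \<open>Vector fields are derivations of the algebra of smooth functions, and tensor fields are
  multilinear maps over that algebra. The algebraic operations on functions and on vector fields are
  the pointwise ones of \<open>HOL-Library.Function_Algebras\<close>.\<close>

type_synonym 'm vfield = "('m \<Rightarrow> real) \<Rightarrow> ('m \<Rightarrow> real)"

definition vscale :: "('m \<Rightarrow> real) \<Rightarrow> 'm vfield \<Rightarrow> 'm vfield" (infixr "\<odot>" 75) where
  "h \<odot> X = (\<lambda>f. h * X f)"

text \<open>The value \<open>0\<close> outside the smooth functions makes equality of vector fields coincide with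
  equality of HOL functions.\<close>

definition vector_fields :: "('m, 'e::euclidean_space) chart set \<Rightarrow> 'm vfield set" where
  "vector_fields A = {X.
     (\<forall>f\<in>smooth_functions A. X f \<in> smooth_functions A) \<and>
     (\<forall>f\<in>smooth_functions A. \<forall>h\<in>smooth_functions A. X (f + h) = X f + X h) \<and>
     (\<forall>c. \<forall>f\<in>smooth_functions A. X (\<lambda>p. c * f p) = (\<lambda>p. c * X f p)) \<and>
     (\<forall>f\<in>smooth_functions A. \<forall>h\<in>smooth_functions A. X (f * h) = f * X h + X f * h) \<and>
     (\<forall>f. f \<notin> smooth_functions A \<longrightarrow> X f = 0)}"

text \<open>The tangent vector of \<open>X\<close> at \<open>p\<close>.\<close>

definition value_at :: "'m vfield \<Rightarrow> 'm \<Rightarrow> ('m \<Rightarrow> real) \<Rightarrow> real" where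
  "value_at X p = (\<lambda>f. X f p)"

definition lie_bracket :: "'m vfield \<Rightarrow> 'm vfield \<Rightarrow> 'm vfield" where
  "lie_bracket X Y = (\<lambda>f. X (Y f) - Y (X f))"

definition one_form ::
    "('m, 'e::euclidean_space) chart set \<Rightarrow> ('m vfield \<Rightarrow> 'm \<Rightarrow> real) \<Rightarrow> bool" where
  "one_form A \<alpha> \<longleftrightarrow>
     (\<forall>X\<in>vector_fields A. \<alpha> X \<in> smooth_functions A) \<and>
     (\<forall>X\<in>vector_fields A. \<forall>Y\<in>vector_fields A. \<alpha> (X + Y) = \<alpha> X + \<alpha> Y) \<and>
     (\<forall>h\<in>smooth_functions A. \<forall>X\<in>vector_fields A. \<alpha> (h \<odot> X) = h * \<alpha> X)"

text \<open>Tensor fields of type \<open>(1,1)\<close>.\<close>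

definition endomorphism_field ::
    "('m, 'e::euclidean_space) chart set \<Rightarrow> ('m vfield \<Rightarrow> 'm vfield) \<Rightarrow> bool" where
  "endomorphism_field A F \<longleftrightarrow>
     (\<forall>X\<in>vector_fields A. F X \<in> vector_fields A) \<and>
     (\<forall>X\<in>vector_fields A. \<forall>Y\<in>vector_fields A. F (X + Y) = F X + F Y) \<and>
     (\<forall>h\<in>smooth_functions A. \<forall>X\<in>vector_fields A. F (h \<odot> X) = h \<odot> F X)"

type_synonym 'm tensor2 = "'m vfield \<Rightarrow> 'm vfield \<Rightarrow> 'm \<Rightarrow> real"

definition riemannian_metric ::
    "('m, 'e::euclidean_space) chart set \<Rightarrow> 'm tensor2 \<Rightarrow> bool" where
  "riemannian_metric A g \<longleftrightarrow>
     (\<forall>X\<in>vector_fields A. one_form A (g X)) \<and>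
     (\<forall>X\<in>vector_fields A. \<forall>Y\<in>vector_fields A. g X Y = g Y X) \<and>
     (\<forall>X\<in>vector_fields A. \<forall>p. value_at X p \<noteq> 0 \<longrightarrow> g X X p > 0)"

section \<open>Traces\<close>

text \<open>Both traces are computed at a point \<open>p\<close>, from vector fields whose values at \<open>p\<close> form a basis of
  the tangent space; the frames are indexed by the standard basis of the model space. The results do
  not depend on the frame.\<close>

definition dual_frames_at ::
    "('m, 'e::euclidean_space) chart set \<Rightarrow> 'm \<Rightarrow> ('e \<Rightarrow> 'm vfield) \<Rightarrow>
     ('e \<Rightarrow> 'm vfield \<Rightarrow> 'm \<Rightarrow> real) \<Rightarrow> bool" where
  "dual_frames_at A p E \<theta> \<longleftrightarrow>
     (\<forall>i\<in>Basis. E i \<in> vector_fields A \<and> one_form A (\<theta> i)) \<and>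
     (\<forall>i\<in>Basis. \<forall>j\<in>Basis. \<theta> i (E j) p = (if i = j then 1 else 0))"

definition field_trace ::
    "('m, 'e::euclidean_space) chart set \<Rightarrow> ('m vfield \<Rightarrow> 'm vfield) \<Rightarrow> 'm \<Rightarrow> real" where
  "field_trace A F p = (THE t. \<exists>E \<theta>. dual_frames_at A p E \<theta> \<and> t = (\<Sum>i\<in>Basis. \<theta> i (F (E i)) p))"

definition orthonormal_frame_at ::
    "('m, 'e::euclidean_space) chart set \<Rightarrow> 'm tensor2 \<Rightarrow> 'm \<Rightarrow> ('e \<Rightarrow> 'm vfield) \<Rightarrow> bool" where
  "orthonormal_frame_at A g p E \<longleftrightarrow>
     (\<forall>i\<in>Basis. E i \<in> vector_fields A) \<and>
     (\<forall>i\<in>Basis. \<forall>j\<in>Basis. g (E i) (E j) p = (if i = j then 1 else 0))"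

definition metric_trace ::
    "('m, 'e::euclidean_space) chart set \<Rightarrow> 'm tensor2 \<Rightarrow> 'm tensor2 \<Rightarrow> 'm \<Rightarrow> real" where
  "metric_trace A g h p =
     (THE t. \<exists>E. orthonormal_frame_at A g p E \<and> t = (\<Sum>i\<in>Basis. h (E i) (E i) p))"

section \<open>Levi-Civita connection and curvature\<close>

type_synonym 'm connection = "'m vfield \<Rightarrow> 'm vfield \<Rightarrow> 'm vfield"

definition affine_connection ::
    "('m, 'e::euclidean_space) chart set \<Rightarrow> 'm connection \<Rightarrow> bool" where
  "affine_connection A nabla \<longleftrightarrow>
     (\<forall>X\<in>vector_fields A. \<forall>Y\<in>vector_fields A. nabla X Y \<in> vector_fields A) \<and>
     (\<forall>X\<in>vector_fields A. \<forall>Y\<in>vector_fields A. \<forall>Z\<in>vector_fields A.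
        nabla (X + Y) Z = nabla X Z + nabla Y Z \<and> nabla X (Y + Z) = nabla X Y + nabla X Z) \<and>
     (\<forall>h\<in>smooth_functions A. \<forall>X\<in>vector_fields A. \<forall>Y\<in>vector_fields A.
        nabla (h \<odot> X) Y = h \<odot> nabla X Y \<and> nabla X (h \<odot> Y) = X h \<odot> Y + h \<odot> nabla X Y)"

definition levi_civita ::
    "('m, 'e::euclidean_space) chart set \<Rightarrow> 'm tensor2 \<Rightarrow> 'm connection \<Rightarrow> bool" where
  "levi_civita A g nabla \<longleftrightarrow>
     affine_connection A nabla \<and>
     (\<forall>X\<in>vector_fields A. \<forall>Y\<in>vector_fields A. nabla X Y - nabla Y X = lie_bracket X Y) \<and>
     (\<forall>X\<in>vector_fields A. \<forall>Y\<in>vector_fields A. \<forall>Z\<in>vector_fields A.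
        X (g Y Z) = g (nabla X Y) Z + g Y (nabla X Z))"

text \<open>With this sign, Kenmotsu manifolds satisfy \<open>R(X,Y)\<xi> = \<eta>(X)Y - \<eta>(Y)X\<close>.\<close>

definition curvature :: "'m connection \<Rightarrow> 'm vfield \<Rightarrow> 'm vfield \<Rightarrow> 'm vfield \<Rightarrow> 'm vfield" where
  "curvature nabla X Y Z =
     nabla X (nabla Y Z) - nabla Y (nabla X Z) - nabla (lie_bracket X Y) Z"

definition ricci :: "('m, 'e::euclidean_space) chart set \<Rightarrow> 'm connection \<Rightarrow> 'm tensor2" where
  "ricci A nabla X Y = field_trace A (\<lambda>Z. curvature nabla Z X Y)"

definition scalar_curvature ::
    "('m, 'e::euclidean_space) chart set \<Rightarrow> 'm tensor2 \<Rightarrow> 'm connection \<Rightarrow> 'm \<Rightarrow> real" where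
  "scalar_curvature A g nabla = metric_trace A g (ricci A nabla)"

definition star_ricci ::
    "('m, 'e::euclidean_space) chart set \<Rightarrow> 'm connection \<Rightarrow> ('m vfield \<Rightarrow> 'm vfield) \<Rightarrow> 'm tensor2"
  where
  "star_ricci A nabla \<Phi> X Y p = 1 / 2 * field_trace A (\<lambda>Z. \<Phi> (curvature nabla X (\<Phi> Y) Z)) p"

definition star_scalar_curvature ::
    "('m, 'e::euclidean_space) chart set \<Rightarrow> 'm tensor2 \<Rightarrow> 'm connection \<Rightarrow>
     ('m vfield \<Rightarrow> 'm vfield) \<Rightarrow> 'm \<Rightarrow> real" where
  "star_scalar_curvature A g nabla \<Phi> = metric_trace A g (star_ricci A nabla \<Phi>)"

definition lie_derivative :: "'m vfield \<Rightarrow> 'm tensor2 \<Rightarrow> 'm tensor2" where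
  "lie_derivative Z h X Y = Z (h X Y) - h (lie_bracket Z X) Y - h X (lie_bracket Z Y)"

section \<open>Kenmotsu manifolds and solitons\<close>

definition almost_contact_metric ::
    "('m, 'e::euclidean_space) chart set \<Rightarrow> ('m vfield \<Rightarrow> 'm vfield) \<Rightarrow> 'm vfield \<Rightarrow>
     ('m vfield \<Rightarrow> 'm \<Rightarrow> real) \<Rightarrow> 'm tensor2 \<Rightarrow> bool" where
  "almost_contact_metric A \<Phi> \<xi> \<eta> g \<longleftrightarrow>
     endomorphism_field A \<Phi> \<and> \<xi> \<in> vector_fields A \<and> one_form A \<eta> \<and> riemannian_metric A g \<and>
     (\<forall>Y\<in>vector_fields A. \<Phi> (\<Phi> Y) = - Y + \<eta> Y \<odot> \<xi>) \<and>
     (\<forall>Y\<in>vector_fields A. \<eta> (\<Phi> Y) = 0) \<and> \<Phi> \<xi> = 0 \<and> \<eta> \<xi> = 1 \<and>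
     (\<forall>X\<in>vector_fields A. \<forall>Y\<in>vector_fields A. g (\<Phi> X) (\<Phi> Y) = g X Y - \<eta> X * \<eta> Y) \<and>
     (\<forall>X\<in>vector_fields A. \<forall>Y\<in>vector_fields A. g X (\<Phi> Y) = - g (\<Phi> X) Y) \<and>
     (\<forall>Y\<in>vector_fields A. g Y \<xi> = \<eta> Y)"

definition kenmotsu ::
    "('m, 'e::euclidean_space) chart set \<Rightarrow> ('m vfield \<Rightarrow> 'm vfield) \<Rightarrow> 'm vfield \<Rightarrow>
     ('m vfield \<Rightarrow> 'm \<Rightarrow> real) \<Rightarrow> 'm tensor2 \<Rightarrow> 'm connection \<Rightarrow> bool" where
  "kenmotsu A \<Phi> \<xi> \<eta> g nabla \<longleftrightarrow>
     almost_contact_metric A \<Phi> \<xi> \<eta> g \<and> levi_civita A g nabla \<and>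
     (\<forall>X\<in>vector_fields A. \<forall>Y\<in>vector_fields A.
        nabla X (\<Phi> Y) - \<Phi> (nabla X Y) = - (g X (\<Phi> Y) \<odot> \<xi>) - \<eta> Y \<odot> \<Phi> X) \<and>
     (\<forall>X\<in>vector_fields A. nabla X \<xi> = X - \<eta> X \<odot> \<xi>)"

definition star_ricci_bourguignon_soliton ::
    "('m, 'e::euclidean_space) chart set \<Rightarrow> ('m vfield \<Rightarrow> 'm vfield) \<Rightarrow> 'm tensor2 \<Rightarrow>
     'm connection \<Rightarrow> 'm vfield \<Rightarrow> real \<Rightarrow> real \<Rightarrow> bool" where
  "star_ricci_bourguignon_soliton A \<Phi> g nabla z \<Omega> \<omega> \<longleftrightarrow>
     z \<in> vector_fields A \<and>
     (\<forall>X\<in>vector_fields A. \<forall>Y\<in>vector_fields A. \<forall>p.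
        lie_derivative z g X Y p + 2 * star_ricci A nabla \<Phi> X Y p =
        2 * (\<Omega> + \<omega> * star_scalar_curvature A g nabla \<Phi> p) * g X Y p)"

definition compressing :: "real \<Rightarrow> bool" where "compressing \<Omega> \<longleftrightarrow> \<Omega> > 0"
definition balancing :: "real \<Rightarrow> bool" where "balancing \<Omega> \<longleftrightarrow> \<Omega> = 0"
definition enlarging :: "real \<Rightarrow> bool" where "enlarging \<Omega> \<longleftrightarrow> \<Omega> < 0"

definition torse_forming ::
    "('m, 'e::euclidean_space) chart set \<Rightarrow> 'm connection \<Rightarrow> 'm vfield \<Rightarrow> ('m \<Rightarrow> real) \<Rightarrow>
     ('m vfield \<Rightarrow> 'm \<Rightarrow> real) \<Rightarrow> bool" where
  "torse_forming A nabla \<rho> \<Psi> \<gamma> \<longleftrightarrow>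
     \<rho> \<in> vector_fields A \<and> (\<forall>p. value_at \<rho> p \<noteq> 0) \<and>
     \<Psi> \<in> smooth_functions A \<and> one_form A \<gamma> \<and>
     (\<forall>Y\<in>vector_fields A. nabla Y \<rho> = \<Psi> \<odot> Y + \<gamma> Y \<odot> \<rho>)"

end

theory Submission
  imports Defs
begin

text \<open>
  Tracing the soliton equation over an orthonormal frame at \<open>p\<close>, with
  \<open>\<L>\<^sub>\<rho> g(X, Y) = 2\<Psi> g(X, Y) + \<gamma>(X) g(\<rho>, Y) + \<gamma>(Y) g(\<rho>, X)\<close>, expresses \<open>\<Omega>\<close> through \<open>\<gamma>(\<rho>)\<close>, \<open>\<Psi>\<close> and \<open>r\<^sup>*\<close>,
  so that only \<open>r\<^sup>* = r + 4n\<^sup>2\<close> remains. Subtracting from \<open>R\<close> the curvature tensor of hyperbolic space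
  leaves a tensor \<open>K\<close> which annihilates \<open>\<xi>\<close> and commutes with \<open>\<Phi>\<close>; as in Kaehler geometry, the first
  Bianchi identity then gives \<open>\<Sum> K(e\<^sub>j, \<Phi>e\<^sub>j, e\<^sub>i, \<Phi>e\<^sub>i) = -2 \<Sum> K(e\<^sub>i, e\<^sub>j, e\<^sub>j, e\<^sub>i)\<close>.

  Traces exist and are independent of the frame because the derivations form, near each point, a free
  module of rank \<open>DIM('e)\<close>: bump functions globalize the coordinate fields, and Hadamard's lemma shows
  that a derivation is determined by its values on the coordinates.
\<close>

section \<open>Calculus of \<open>C\<^sup>k\<close> functions\<close>

text \<open>Why \<open>K\<close> has these symmetries: a Kenmotsu manifold is locally a warped
  product of a line and a Kaehler manifold with warping function e^t, and \<open>K\<close> is, up to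
  lowering an index, the curvature of the Kaehler factor. The product is never constructed; the
  symmetries are read off from the commutators of covariant derivatives applied to
  \<open>\<xi>\<close> and \<open>\<Phi>\<close>. The constant 4n^2 comes from the hyperbolic part:
  in dimension N = 2n + 1 it contributes -N(N - 1) to r and -(N - 1) to the star-scalar curvature,
  and these differ by (N - 1)^2. The traces are definite descriptions at a point, and the Ricci
  tensors are themselves such traces, so smoothness in the point does not come for free. All trace
  arguments therefore stay at one fixed \<open>p\<close> and ask only for
  \<open>covector_at\<close>. A covector takes global fields as arguments, so a local identity has
  to be multiplied by a bump function before a covector can be applied to it.\<close>

lemma Ck_on_cong:
  assumes "open S" "Ck_on k S f" "\<And>x. x \<in> S \<Longrightarrow> f x = g x"
  shows "Ck_on k S g"
  using assms(2,3)
proof (induction k arbitrary: f g)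
  case 0
  then show ?case by (simp cong: continuous_on_cong)
next
  case (Suc k)
  have d: "(g has_derivative frechet_derivative f (at x)) (at x)" if "x \<in> S" for x
    using Suc.prems that \<open>open S\<close>
    by (auto simp: frechet_derivative_works intro: has_derivative_transform_within_open)
  then have e: "frechet_derivative f (at x) = frechet_derivative g (at x)" if "x \<in> S" for x
    using frechet_derivative_at that by blast
  show ?case
    using Suc.IH[of "\<lambda>x. frechet_derivative f (at x) _" "\<lambda>x. frechet_derivative g (at x) _"]
      Suc.prems(1) d e by (auto simp: differentiable_def)
qed

text \<open>Replaces the choice operator behind \<open>frechet_derivative\<close> by any explicit
  derivative formula, so that the inductions below can use the usual differentiation rules.
  Uniqueness of the derivative makes the two agree on \<open>S\<close>.\<close>

lemma Ck_on_SucI: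
  assumes "\<And>x. x \<in> S \<Longrightarrow> (f has_derivative f' x) (at x)" and "\<And>v. Ck_on k S (\<lambda>x. f' x v)"
    and "open S"
  shows "Ck_on (Suc k) S f"
proof -
  have "f' x = frechet_derivative f (at x)" if "x \<in> S" for x
    using assms(1) frechet_derivative_at that by blast
  then show ?thesis
    using assms(1) Ck_on_cong[OF assms(3,2)] by (auto simp: differentiable_def)
qed

lemma Ck_on_SucD:
  assumes "Ck_on (Suc k) S f" "x \<in> S"
  shows "(f has_derivative frechet_derivative f (at x)) (at x)"
  using assms by (simp add: frechet_derivative_works)

lemma Ck_on_Suc_imp: "Ck_on (Suc k) S f \<Longrightarrow> Ck_on k S f"
proof (induction k arbitrary: f)
  case 0
  then show ?case
    by (auto intro!: continuous_at_imp_continuous_on differentiable_imp_continuous_within)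
qed auto

lemma Ck_on_subset: "Ck_on k S f \<Longrightarrow> T \<subseteq> S \<Longrightarrow> Ck_on k T f"
  by (induction k arbitrary: f) (auto intro: continuous_on_subset)

lemma Ck_on_local:
  assumes "\<And>x. x \<in> S \<Longrightarrow> \<exists>T. open T \<and> x \<in> T \<and> Ck_on k T f"
  shows "Ck_on k S f"
  using assms
proof (induction k arbitrary: f)
  case 0
  then show ?case
    by (metis Ck_on.simps(1) continuous_at_imp_continuous_on continuous_on_eq_continuous_at)
next
  case (Suc k)
  have "Ck_on k S (\<lambda>x. frechet_derivative f (at x) v)" for v
    by (rule Suc.IH) (use Suc.prems in force)
  then show ?case using Suc.prems by fastforce
qed

lemma Ck_on_const: "open S \<Longrightarrow> Ck_on k S (\<lambda>x. c)"
  by (induction k arbitrary: c) (auto intro!: Ck_on_SucI derivative_eq_intros simp del: Ck_on.simps(2))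

lemma Ck_on_bounded_linear: "open S \<Longrightarrow> bounded_linear f \<Longrightarrow> Ck_on k S f"
  by (cases k) (auto intro!: Ck_on_SucI bounded_linear_imp_has_derivative Ck_on_const
      linear_continuous_on simp del: Ck_on.simps(2))

lemma Ck_on_add:
  "open S \<Longrightarrow> Ck_on k S f \<Longrightarrow> Ck_on k S g \<Longrightarrow> Ck_on k S (\<lambda>x. f x + g x)"
proof (induction k arbitrary: f g)
  case 0
  then show ?case by (auto intro: continuous_intros)
next
  case (Suc k)
  show ?case
    by (rule Ck_on_SucI[OF has_derivative_add[OF Ck_on_SucD Ck_on_SucD]])
      (use Suc in auto)
qed

lemma Ck_on_sum:
  "open S \<Longrightarrow> (\<And>i. i \<in> I \<Longrightarrow> Ck_on k S (f i)) \<Longrightarrow> Ck_on k S (\<lambda>x. \<Sum>i\<in>I. f i x)"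
  by (induction I rule: infinite_finite_induct) (auto intro: Ck_on_add Ck_on_const)

lemma (in bounded_bilinear) Ck_on:
  "open S \<Longrightarrow> Ck_on k S f \<Longrightarrow> Ck_on k S g \<Longrightarrow> Ck_on k S (\<lambda>x. prod (f x) (g x))"
proof (induction k arbitrary: f g)
  case 0
  then show ?case by (auto intro: continuous_on)
next
  case (Suc k)
  show ?case
  proof (rule Ck_on_SucI[OF FDERIV[OF Ck_on_SucD Ck_on_SucD]])
    fix v
    show "Ck_on k S (\<lambda>x. prod (f x) (frechet_derivative g (at x) v)
        + prod (frechet_derivative f (at x) v) (g x))"
      using Suc by (intro Ck_on_add Suc.IH Ck_on_Suc_imp[of k S f] Ck_on_Suc_imp[of k S g]) auto
  qed (use Suc in auto)
qed

lemmas Ck_on_mult = bounded_bilinear.Ck_on[OF bounded_bilinear_mult]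
lemmas Ck_on_scaleR = bounded_bilinear.Ck_on[OF bounded_bilinear_scaleR]
lemmas Ck_on_inner = bounded_bilinear.Ck_on[OF bounded_bilinear_inner]

lemma Ck_on_inverse:
  fixes f :: "'a::euclidean_space \<Rightarrow> real"
  shows "open S \<Longrightarrow> (\<And>x. x \<in> S \<Longrightarrow> f x \<noteq> 0) \<Longrightarrow> Ck_on k S f \<Longrightarrow> Ck_on k S (\<lambda>x. inverse (f x))"
proof (induction k)
  case 0
  then show ?case by (auto intro: continuous_intros)
next
  case (Suc k)
  show ?case
  proof (rule Ck_on_SucI)
    show "((\<lambda>x. inverse (f x)) has_derivative
        (\<lambda>v. (- 1) * (inverse (f x) * (frechet_derivative f (at x) v * inverse (f x))))) (at x)"
      if "x \<in> S" for x
      using Deriv.has_derivative_inverse[OF Suc.prems(2)[OF that] Ck_on_SucD[OF Suc.prems(3) that]]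
      by (simp add: mult.assoc)
    fix v
    have "Ck_on k S (\<lambda>x. inverse (f x))"
      by (rule Suc.IH[OF Suc.prems(1,2) Ck_on_Suc_imp[OF Suc.prems(3)]])
    then show "Ck_on k S (\<lambda>x. (- 1) *
        (inverse (f x) * (frechet_derivative f (at x) v * inverse (f x))))"
      using Suc.prems by (intro Ck_on_mult Ck_on_const) auto
  qed (rule Suc.prems)
qed

lemma linear_expansion:
  fixes f :: "'a::euclidean_space \<Rightarrow> 'b::real_vector"
  assumes "linear f"
  shows "f v = (\<Sum>i\<in>Basis. (v \<bullet> i) *\<^sub>R f i)"
proof -
  have "f (\<Sum>i\<in>Basis. (v \<bullet> i) *\<^sub>R i) = (\<Sum>i\<in>Basis. (v \<bullet> i) *\<^sub>R f i)"
    using assms by (simp add: linear_sum linear_cmul)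
  then show ?thesis by (simp add: euclidean_representation)
qed

lemma Ck_on_compose:
  fixes g :: "'a::euclidean_space \<Rightarrow> 'b::euclidean_space"
  shows "open S \<Longrightarrow> open T \<Longrightarrow> g ` S \<subseteq> T \<Longrightarrow> Ck_on k T f \<Longrightarrow> Ck_on k S g \<Longrightarrow> Ck_on k S (\<lambda>x. f (g x))"
proof (induction k arbitrary: f)
  case 0
  then show ?case by (auto intro: continuous_on_compose2)
next
  case (Suc k)
  define df where "df = (\<lambda>y v. frechet_derivative f (at y) v)"
  define dg where "dg = (\<lambda>x v. frechet_derivative g (at x) v)"
  \<comment> \<open>The chain rule yields \<open>df (g x) (dg x v)\<close>, in which the map and its
    argument both vary with \<open>x\<close>. Expanding the argument in the basis leaves products of
    \<open>C\<^sup>k\<close> functions, where each \<open>df (g x) i\<close> falls under the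
    induction hypothesis.\<close>
  have lin: "df y v = (\<Sum>i\<in>Basis. (v \<bullet> i) *\<^sub>R df y i)" if "y \<in> T" for y v
    using Ck_on_SucD[OF Suc.prems(4) that] has_derivative_linear linear_expansion
    unfolding df_def by blast
  show ?case
  proof (rule Ck_on_SucI)
    fix x assume x: "x \<in> S"
    then have gx: "g x \<in> T" using Suc.prems by auto
    have "((f \<circ> g) has_derivative (df (g x) \<circ> dg x)) (at x)"
      unfolding df_def dg_def
      by (rule diff_chain_at[OF Ck_on_SucD[OF Suc.prems(5) x] Ck_on_SucD[OF Suc.prems(4) gx]])
    then show "((\<lambda>x. f (g x)) has_derivative (\<lambda>v. \<Sum>i\<in>Basis. (dg x v \<bullet> i) *\<^sub>R df (g x) i)) (at x)"
      by (simp add: o_def lin[OF gx, symmetric])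
  next
    fix v
    have dg: "Ck_on k S (\<lambda>x. dg x v)" using Suc.prems by (simp add: dg_def)
    have "Ck_on k S (\<lambda>x. df (g x) i)" for i
      by (rule Suc.IH) (use Suc.prems Ck_on_Suc_imp[OF Suc.prems(5)] in \<open>auto simp: df_def\<close>)
    with dg show "Ck_on k S (\<lambda>x. \<Sum>i\<in>Basis. (dg x v \<bullet> i) *\<^sub>R df (g x) i)"
      using Suc.prems by (intro Ck_on_sum Ck_on_scaleR Ck_on_inner Ck_on_const) auto
  qed (rule Suc.prems)
qed

lemma smooth_on_cong: "open S \<Longrightarrow> (\<And>x. x \<in> S \<Longrightarrow> f x = g x) \<Longrightarrow> smooth_on S f \<Longrightarrow> smooth_on S g"
  unfolding smooth_on_def using Ck_on_cong by blast

lemma smooth_on_subset: "smooth_on S f \<Longrightarrow> T \<subseteq> S \<Longrightarrow> smooth_on T f"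
  unfolding smooth_on_def using Ck_on_subset by blast

lemma smooth_on_local:
  "(\<And>x. x \<in> S \<Longrightarrow> \<exists>T. open T \<and> x \<in> T \<and> smooth_on T f) \<Longrightarrow> smooth_on S f"
  unfolding smooth_on_def by (meson Ck_on_local)

lemma smooth_on_const: "open S \<Longrightarrow> smooth_on S (\<lambda>x. c)"
  unfolding smooth_on_def by (simp add: Ck_on_const)

lemma smooth_on_bounded_linear: "open S \<Longrightarrow> bounded_linear f \<Longrightarrow> smooth_on S f"
  unfolding smooth_on_def by (simp add: Ck_on_bounded_linear)

lemma smooth_on_add:
  "open S \<Longrightarrow> smooth_on S f \<Longrightarrow> smooth_on S g \<Longrightarrow> smooth_on S (\<lambda>x. f x + g x)"
  unfolding smooth_on_def by (simp add: Ck_on_add)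

lemma smooth_on_mult:
  fixes f g :: "_ \<Rightarrow> real"
  shows "open S \<Longrightarrow> smooth_on S f \<Longrightarrow> smooth_on S g \<Longrightarrow> smooth_on S (\<lambda>x. f x * g x)"
  unfolding smooth_on_def by (simp add: Ck_on_mult)

lemma smooth_on_inverse:
  fixes f :: "_ \<Rightarrow> real"
  shows "open S \<Longrightarrow> (\<And>x. x \<in> S \<Longrightarrow> f x \<noteq> 0) \<Longrightarrow> smooth_on S f \<Longrightarrow> smooth_on S (\<lambda>x. inverse (f x))"
  unfolding smooth_on_def by (simp add: Ck_on_inverse)

lemma smooth_on_inner:
  "open S \<Longrightarrow> smooth_on S f \<Longrightarrow> smooth_on S g \<Longrightarrow> smooth_on S (\<lambda>x. f x \<bullet> g x)"
  unfolding smooth_on_def by (simp add: Ck_on_inner)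

lemma smooth_on_diff_const:
  "open S \<Longrightarrow> smooth_on S f \<Longrightarrow> smooth_on S (\<lambda>x. f x - c)"
  using smooth_on_add[OF _ _ smooth_on_const, of S f "- c"] by simp

lemma smooth_on_compose:
  fixes g :: "'a::euclidean_space \<Rightarrow> 'b::euclidean_space"
  shows "open S \<Longrightarrow> open T \<Longrightarrow> g ` S \<subseteq> T \<Longrightarrow> smooth_on T f \<Longrightarrow> smooth_on S g \<Longrightarrow> smooth_on S (\<lambda>x. f (g x))"
  unfolding smooth_on_def by (blast intro: Ck_on_compose)

lemma smooth_on_has_derivative:
  "smooth_on S f \<Longrightarrow> x \<in> S \<Longrightarrow> (f has_derivative frechet_derivative f (at x)) (at x)"
  unfolding smooth_on_def using Ck_on_SucD by blast

lemma smooth_on_imp_continuous_on: "smooth_on S f \<Longrightarrow> continuous_on S f"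
  unfolding smooth_on_def by (drule spec[of _ 0]) simp

lemma smooth_on_frechet_derivative:
  "smooth_on S f \<Longrightarrow> smooth_on S (\<lambda>x. frechet_derivative f (at x) v)"
  unfolding smooth_on_def using Ck_on.simps(2) by blast

section \<open>Bump functions\<close>

text \<open>For \<open>k = 0\<close> the classical flat function. The powers of
  \<open>inverse t\<close> close the family under differentiation up to linear combinations, so one
  induction over the order of differentiability treats all members together.\<close>

definition flat_fun :: "nat \<Rightarrow> real \<Rightarrow> real" where
  "flat_fun k t = (if t > 0 then exp (- inverse t) * inverse t ^ k else 0)"

text \<open>A single term of the exponential series at \<open>inverse t\<close>, the one of degree
  \<open>k + 2\<close>, is at most \<open>exp (inverse t)\<close>. Two degrees more than
  \<open>k\<close> leave a factor \<open>t\<^sup>2\<close>, which forces the derivative at 0 to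
  vanish.\<close>

lemma flat_fun_le_square: "\<bar>flat_fun k t\<bar> \<le> fact (k + 2) * t\<^sup>2"
proof (cases "t > 0")
  case True
  have "inverse t ^ (k + 2) / fact (k + 2) \<le> exp (inverse t)"
    using sum_le_suminf[OF summable_exp_generic[of "inverse t"], of "{k + 2}"] True
    by (simp add: exp_def field_simps)
  then have "inverse t ^ (k + 2) \<le> exp (inverse t) * fact (k + 2)"
    by (simp only: pos_divide_le_eq fact_gt_zero)
  then have "exp (- inverse t) * inverse t ^ (k + 2) * t\<^sup>2
      \<le> exp (- inverse t) * (exp (inverse t) * fact (k + 2)) * t\<^sup>2"
    by (intro mult_left_mono mult_right_mono) auto
  then have "exp (- inverse t) * (inverse t ^ k * (inverse t * t)\<^sup>2)
      \<le> (exp (- inverse t) * exp (inverse t)) * (fact (k + 2) * t\<^sup>2)"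
    by (simp only: power_add power_mult_distrib mult_ac)
  then show ?thesis using True
    by (simp add: flat_fun_def exp_minus)
qed (simp add: flat_fun_def)

lemma flat_fun_has_derivative:
  "(flat_fun k has_real_derivative flat_fun (k + 2) t - real k * flat_fun (k + 1) t) (at t)"
proof -
  consider "t > 0" | "t < 0" | "t = 0" by linarith
  then show ?thesis
  proof cases
    case 1
    have "((\<lambda>t. exp (- inverse t) * inverse t ^ k) has_real_derivative
        flat_fun (k + 2) t - real k * flat_fun (k + 1) t) (at t)"
      using 1 by (auto intro!: derivative_eq_intros simp: flat_fun_def algebra_simps power2_eq_square)
        (metis One_nat_def power_eq_if)
    then show ?thesis
      by (rule has_field_derivative_transform_within_open[where S = "{0<..}"])
        (use 1 in \<open>auto simp: flat_fun_def\<close>)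
  next
    case 2
    have "((\<lambda>t. 0) has_real_derivative flat_fun (k + 2) t - real k * flat_fun (k + 1) t) (at t)"
      using 2 by (simp add: flat_fun_def)
    then show ?thesis
      by (rule has_field_derivative_transform_within_open[where S = "{..<0}"])
        (use 2 in \<open>auto simp: flat_fun_def\<close>)
  next
    case 3
    have "((\<lambda>h. (flat_fun k (0 + h) - flat_fun k 0) / h) \<longlongrightarrow> 0) (at 0)"
    proof (rule Lim_null_comparison)
      have "norm ((flat_fun k (0 + h) - flat_fun k 0) / h) \<le> fact (k + 2) * \<bar>h\<bar>" if "h \<noteq> 0" for h
      proof -
        have "\<bar>flat_fun k h\<bar> / \<bar>h\<bar> \<le> fact (k + 2) * h\<^sup>2 / \<bar>h\<bar>"
          using flat_fun_le_square[of k h] by (intro divide_right_mono) auto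
        also have "\<dots> = fact (k + 2) * \<bar>h\<bar>"
          using that by (simp add: power2_eq_square abs_if)
        finally show ?thesis by (simp add: flat_fun_def[of k 0])
      qed
      then show "\<forall>\<^sub>F h in at 0. norm ((flat_fun k (0 + h) - flat_fun k 0) / h) \<le> fact (k + 2) * \<bar>h\<bar>"
        by (simp add: eventually_at_filter)
      show "((\<lambda>h::real. fact (k + 2) * \<bar>h\<bar>) \<longlongrightarrow> 0) (at 0)"
        by (auto intro!: tendsto_eq_intros)
    qed
    then show ?thesis using 3 by (simp add: DERIV_def flat_fun_def)
  qed
qed

lemma smooth_on_flat_fun: "smooth_on UNIV (flat_fun j)"
proof -
  have "Ck_on k UNIV (flat_fun j)" for k
  proof (induction k arbitrary: j)
    case 0
    show ?case
      by (auto intro!: DERIV_continuous_on[OF flat_fun_has_derivative])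
  next
    case (Suc k)
    show ?case
    proof (rule Ck_on_SucI)
      show "(flat_fun j has_derivative
          (\<lambda>v. (flat_fun (j + 2) t + (- real j) * flat_fun (j + 1) t) * v)) (at t)" for t
        using flat_fun_has_derivative[of j t] by (simp add: has_field_derivative_def)
    qed (intro Ck_on_mult Ck_on_add Ck_on_const Suc.IH open_UNIV)+
  qed
  then show ?thesis by (simp add: smooth_on_def)
qed

text \<open>The usual quotient of flat functions, written in the squared distance \<open>N\<close>
  because the distance itself is not smooth at \<open>q\<close>. The denominator is positive since
  \<open>s < t\<close> makes at least one of \<open>N x < t\<^sup>2\<close> and
  \<open>N x > s\<^sup>2\<close> true.\<close>

lemma ex_smooth_bump:
  fixes q :: "'a::euclidean_space"
  assumes "0 < s" "s < t"
  shows "\<exists>b :: 'a \<Rightarrow> real. smooth_on UNIV b \<and> (\<forall>x\<in>cball q s. b x = 1) \<and> (\<forall>x. x \<notin> ball q t \<longrightarrow> b x = 0)"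
proof -
  define N where "N = (\<lambda>x::'a. (x - q) \<bullet> (x - q))"
  define c where "c = flat_fun 0"
  define b where "b = (\<lambda>x. c (t\<^sup>2 + (- 1) * N x) * inverse (c (t\<^sup>2 + (- 1) * N x) + c (N x - s\<^sup>2)))"
  have N: "N x = (dist q x)\<^sup>2" for x
    by (simp add: N_def dist_norm norm_minus_commute[of q x] power2_norm_eq_inner)
  have lt: "s\<^sup>2 < t\<^sup>2" using assms by (simp add: power_strict_mono)
  have c_nonneg: "c y \<ge> 0" and c_pos: "c y > 0 \<longleftrightarrow> y > 0" for y
    by (auto simp: c_def flat_fun_def)
  have ne: "c (t\<^sup>2 + (- 1) * N x) + c (N x - s\<^sup>2) \<noteq> 0" for x
    using c_nonneg[of "t\<^sup>2 + (- 1) * N x"] c_nonneg[of "N x - s\<^sup>2"] c_pos[of "t\<^sup>2 + (- 1) * N x"]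
      c_pos[of "N x - s\<^sup>2"] lt by linarith
  have id: "smooth_on UNIV (\<lambda>x::'a. x)"
    by (simp add: smooth_on_bounded_linear bounded_linear_ident)
  have smN: "smooth_on UNIV N" unfolding N_def
    by (intro smooth_on_inner smooth_on_diff_const id open_UNIV)
  have smc: "smooth_on UNIV (\<lambda>x. c (f x))" if "smooth_on UNIV f" for f :: "'a \<Rightarrow> real"
    unfolding c_def by (rule smooth_on_compose[OF _ _ _ smooth_on_flat_fun that]) auto
  have "smooth_on UNIV b" unfolding b_def
    by (intro smooth_on_mult smooth_on_inverse ne smooth_on_add smc smooth_on_const
        smooth_on_diff_const smN open_UNIV)
  moreover have "b x = 1" if "x \<in> cball q s" for x
  proof -
    have "N x \<le> s\<^sup>2" using that assms by (simp add: N power_mono)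
    then have "c (N x - s\<^sup>2) = 0" by (simp add: c_def flat_fun_def)
    then show ?thesis using ne[of x] by (simp add: b_def)
  qed
  moreover have "b x = 0" if "x \<notin> ball q t" for x
  proof -
    have "N x \<ge> t\<^sup>2" using that assms by (simp add: N power_mono)
    then show ?thesis by (simp add: b_def c_def flat_fun_def)
  qed
  ultimately show ?thesis by blast
qed

section \<open>Hadamard's lemma\<close>

text \<open>Differentiating \<open>f (a + t *\<^sub>R (x - a))\<close> in \<open>x\<close> brings
  out a factor \<open>t\<close>. The weight \<open>t ^ j\<close> absorbs it, so that each partial
  derivative is again an integral of the same shape, with \<open>Suc j\<close> and a partial
  derivative of \<open>f\<close>.\<close>

lemma Ck_on_radial_integral:
  fixes f :: "'a::euclidean_space \<Rightarrow> real"
  assumes "smooth_on (ball a s) f"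
  shows "Ck_on k (ball a s) (\<lambda>x. integral {0..1} (\<lambda>t. t ^ j * f (a + t *\<^sub>R (x - a))))"
  using assms
proof (induction k arbitrary: f j)
  have mem: "a + t *\<^sub>R (x - a) \<in> ball a s" if "x \<in> ball a s" "t \<in> cbox 0 (1::real)" for x t
  proof -
    have "\<bar>t\<bar> * norm (x - a) \<le> norm (x - a)"
      using that by (auto intro: mult_left_le_one_le)
    then show ?thesis using that by (simp add: dist_norm norm_minus_commute)
  qed
  have cont: "continuous_on (ball a s \<times> cbox 0 (1::real)) (\<lambda>(x, t). t ^ j * h (a + t *\<^sub>R (x - a)))"
    if "smooth_on (ball a s) h" for h :: "'a \<Rightarrow> real" and j
  proof -
    have "continuous_on (ball a s \<times> cbox 0 (1::real)) (\<lambda>p. h (a + snd p *\<^sub>R (fst p - a)))"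
    proof (rule continuous_on_compose2[OF smooth_on_imp_continuous_on[OF that]])
      show "continuous_on (ball a s \<times> cbox 0 (1::real)) (\<lambda>p. a + snd p *\<^sub>R (fst p - a))"
        by (intro continuous_intros)
      show "(\<lambda>p. a + snd p *\<^sub>R (fst p - a)) ` (ball a s \<times> cbox 0 1) \<subseteq> ball a s"
        using mem by (auto simp del: mem_ball)
    qed
    then have "continuous_on (ball a s \<times> cbox 0 (1::real))
        (\<lambda>p. snd p ^ j * h (a + snd p *\<^sub>R (fst p - a)))"
      by (intro continuous_on_mult continuous_on_power continuous_on_snd continuous_on_id)
    then show ?thesis by (simp add: case_prod_beta')
  qed
  have cont1: "continuous_on (cbox 0 (1::real)) (\<lambda>t. t ^ j * h (a + t *\<^sub>R (x - a)))"
    if "smooth_on (ball a s) h" "x \<in> ball a s" for h :: "'a \<Rightarrow> real" and j x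
  proof -
    have "continuous_on (cbox 0 1) (\<lambda>t::real. case (x, t) of (x, t) \<Rightarrow> t ^ j * h (a + t *\<^sub>R (x - a)))"
      by (rule continuous_on_compose2[OF cont[OF that(1)]])
        (use that in \<open>auto intro: continuous_on_Pair\<close>)
    then show ?thesis by simp
  qed
  {
    case 0
    show ?case
      using integral_continuous_on_param[OF cont[OF 0]] by simp
  next
    case (Suc k)
    let ?df = "\<lambda>i x. frechet_derivative f (at x) i"
    \<comment> \<open>\<open>leibniz_rule\<close> takes the derivative as a bounded linear map
      depending continuously on \<open>(x, t)\<close>. In the basis of coordinate functionals this
      continuity reduces to that of the partial derivatives.\<close>
    define F where "F = (\<lambda>x t. \<Sum>i\<in>Basis. (t ^ Suc j * ?df i (a + t *\<^sub>R (x - a))) *\<^sub>R blinfun_inner_left i)"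
    have smdf: "smooth_on (ball a s) (?df i)" for i
      using Suc.prems by (rule smooth_on_frechet_derivative)
    have "((\<lambda>x. integral (cbox 0 1) (\<lambda>t. t ^ j * f (a + t *\<^sub>R (x - a)))) has_derivative
        integral (cbox 0 1) (F x)) (at x)" if x: "x \<in> ball a s" for x
    proof -
      have "((\<lambda>x. integral (cbox 0 1) (\<lambda>t. t ^ j * f (a + t *\<^sub>R (x - a)))) has_derivative
          integral (cbox 0 1) (F x)) (at x within ball a s)"
      proof (rule leibniz_rule)
        fix x t assume x: "x \<in> ball a s" and t: "t \<in> cbox 0 (1::real)"
        let ?y = "a + t *\<^sub>R (x - a)"
        have f: "(f has_derivative frechet_derivative f (at ?y)) (at ?y)"
          using smooth_on_has_derivative[OF Suc.prems mem[OF x t]] .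
        have "((\<lambda>x. f (a + t *\<^sub>R (x - a))) has_derivative
            (\<lambda>v. frechet_derivative f (at ?y) (t *\<^sub>R v))) (at x)"
          by (rule has_derivative_compose[where f = "\<lambda>x. a + t *\<^sub>R (x - a)" and g = f])
            (use f in \<open>auto intro!: derivative_eq_intros\<close>)
        then have "((\<lambda>x. t ^ j * f (a + t *\<^sub>R (x - a))) has_derivative
            (\<lambda>v. t ^ j * frechet_derivative f (at ?y) (t *\<^sub>R v))) (at x)"
          by (rule has_derivative_mult_right)
        moreover have "t ^ j * frechet_derivative f (at ?y) (t *\<^sub>R v) = F x t v" for v
        proof -
          have lin: "linear (frechet_derivative f (at ?y))" using f has_derivative_linear by blast
          have "t ^ j * frechet_derivative f (at ?y) (t *\<^sub>R v) = t ^ Suc j * frechet_derivative f (at ?y) v"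
            using lin by (simp add: linear_cmul)
          also have "\<dots> = t ^ Suc j * (\<Sum>i\<in>Basis. (v \<bullet> i) * ?df i ?y)"
            using linear_expansion[OF lin, of v] by simp
          also have "\<dots> = F x t v"
            by (simp add: F_def blinfun.bilinear_simps sum_distrib_left mult_ac)
          finally show ?thesis .
        qed
        ultimately show "((\<lambda>x. t ^ j * f (a + t *\<^sub>R (x - a))) has_derivative F x t) (at x within ball a s)"
          by (simp add: has_derivative_at_withinI)
      next
        fix x assume "x \<in> ball a s"
        then show "(\<lambda>t. t ^ j * f (a + t *\<^sub>R (x - a))) integrable_on cbox 0 1"
          by (intro integrable_continuous cont1 Suc.prems)
      next
        show "continuous_on (ball a s \<times> cbox 0 1) (\<lambda>(x, t). F x t)"
          unfolding F_def case_prod_beta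
          by (intro continuous_on_sum continuous_on_scaleR continuous_on_const
              cont[OF smdf, unfolded case_prod_beta])
      qed (use x in auto)
      then show ?thesis using x by (simp add: at_within_open[OF _ open_ball])
    qed
    moreover have "blinfun_apply (integral (cbox 0 1) (F x)) v =
        (\<Sum>i\<in>Basis. (v \<bullet> i) * integral {0..1} (\<lambda>t. t ^ Suc j * ?df i (a + t *\<^sub>R (x - a))))"
      if x: "x \<in> ball a s" for x v
    proof -
      have "((\<lambda>t. t ^ Suc j * ?df i (a + t *\<^sub>R (x - a))) has_integral
          integral {0..1} (\<lambda>t. t ^ Suc j * ?df i (a + t *\<^sub>R (x - a)))) (cbox 0 1)" for i
        unfolding box_real(2)[symmetric]
        by (intro integrable_integral integrable_continuous cont1 smdf x)
      then have "(F x has_integral (\<Sum>i\<in>Basis. integral {0..1}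
          (\<lambda>t. t ^ Suc j * ?df i (a + t *\<^sub>R (x - a))) *\<^sub>R blinfun_inner_left i)) (cbox 0 1)"
        unfolding F_def by (intro has_integral_sum has_integral_scaleR_left finite_Basis)
      then have "integral (cbox 0 1) (F x) = (\<Sum>i\<in>Basis. integral {0..1}
          (\<lambda>t. t ^ Suc j * ?df i (a + t *\<^sub>R (x - a))) *\<^sub>R blinfun_inner_left i)"
        by (rule integral_unique)
      then show ?thesis
        by (simp add: blinfun.bilinear_simps blinfun.sum_left mult.commute inner_commute)
    qed
    ultimately have "((\<lambda>x. integral {0..1} (\<lambda>t. t ^ j * f (a + t *\<^sub>R (x - a)))) has_derivative
        (\<lambda>v. \<Sum>i\<in>Basis. (v \<bullet> i) * integral {0..1} (\<lambda>t. t ^ Suc j * ?df i (a + t *\<^sub>R (x - a))))) (at x)"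
      if "x \<in> ball a s" for x
      using that by (metis (no_types, lifting) box_real(2) ext)
    note D = this
    show ?case
    proof (rule Ck_on_SucI)
      show "Ck_on k (ball a s) (\<lambda>x. \<Sum>i\<in>Basis. (v \<bullet> i) *
          integral {0..1} (\<lambda>t. t ^ Suc j * ?df i (a + t *\<^sub>R (x - a))))" for v
        by (intro Ck_on_sum Ck_on_mult Ck_on_const Suc.IH smdf open_ball)
    qed (rule D open_ball, assumption?)+
  }
qed

text \<open>Integrate the derivative of \<open>f\<close> along the segment from \<open>a\<close> to
  \<open>x\<close>. The coefficient \<open>h i\<close> is the mean of the partial derivative in
  direction \<open>i\<close> over that segment, and at \<open>x = a\<close> the segment shrinks to a
  point.\<close>

lemma hadamard:
  fixes f :: "'a::euclidean_space \<Rightarrow> real"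
  assumes "smooth_on (ball a s) f"
  obtains h where "\<And>i. smooth_on (ball a s) (h i)" "\<And>i. h i a = frechet_derivative f (at a) i"
    "\<And>x. x \<in> ball a s \<Longrightarrow> f x = f a + (\<Sum>i\<in>Basis. ((x - a) \<bullet> i) * h i x)"
proof -
  define h where "h = (\<lambda>i x. integral {0..1} (\<lambda>t. frechet_derivative f (at (a + t *\<^sub>R (x - a))) i))"
  have "smooth_on (ball a s) (h i)" for i
    using Ck_on_radial_integral[OF smooth_on_frechet_derivative[OF assms], of _ 0 i]
    by (simp add: smooth_on_def h_def)
  moreover have "h i a = frechet_derivative f (at a) i" for i
    by (simp add: h_def)
  moreover have "f x = f a + (\<Sum>i\<in>Basis. ((x - a) \<bullet> i) * h i x)" if x: "x \<in> ball a s" for x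
  proof -
    let ?y = "\<lambda>t. a + t *\<^sub>R (x - a)"
    let ?D = "\<lambda>i t. frechet_derivative f (at (?y t)) i"
    have mem: "?y t \<in> ball a s" if "t \<in> {0..1}" for t
    proof -
      have "\<bar>t\<bar> * norm (x - a) \<le> norm (x - a)"
        using that by (auto intro: mult_left_le_one_le)
      then show ?thesis using x by (simp add: dist_norm norm_minus_commute)
    qed
    have d: "((\<lambda>t. f (?y t)) has_vector_derivative (\<Sum>i\<in>Basis. ((x - a) \<bullet> i) * ?D i t)) (at t within {0..1})"
      if "t \<in> {0..1}" for t
    proof -
      have f: "(f has_derivative frechet_derivative f (at (?y t))) (at (?y t))"
        using smooth_on_has_derivative[OF assms mem[OF that]] .
      then have lin: "linear (frechet_derivative f (at (?y t)))" using has_derivative_linear by blast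
      have eq: "frechet_derivative f (at (?y t)) (x - a) = (\<Sum>i\<in>Basis. ((x - a) \<bullet> i) * ?D i t)"
        using linear_expansion[OF lin, of "x - a"] by simp
      have "((\<lambda>t. f (?y t)) has_derivative (\<lambda>r. frechet_derivative f (at (?y t)) (r *\<^sub>R (x - a)))) (at t within {0..1})"
        by (rule has_derivative_compose[where f = ?y and g = f])
          (use f in \<open>auto intro!: derivative_eq_intros\<close>)
      then show ?thesis
        unfolding has_vector_derivative_def eq[symmetric] using lin by (simp add: linear_cmul)
    qed
    have "((\<lambda>t. \<Sum>i\<in>Basis. ((x - a) \<bullet> i) * ?D i t) has_integral (f (?y 1) - f (?y 0))) {0..1}"
      by (rule fundamental_theorem_of_calculus) (use d in auto)
    moreover have "((\<lambda>t. \<Sum>i\<in>Basis. ((x - a) \<bullet> i) * ?D i t) has_integral (\<Sum>i\<in>Basis. ((x - a) \<bullet> i) * h i x)) {0..1}"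
    proof (intro has_integral_sum has_integral_mult_right finite_Basis)
      fix i
      have "continuous_on (ball a s) (\<lambda>x. frechet_derivative f (at x) i)"
        by (intro smooth_on_imp_continuous_on smooth_on_frechet_derivative assms)
      then have "continuous_on {0..1} (?D i)"
        by (rule continuous_on_compose2) (use mem in \<open>auto intro!: continuous_intros\<close>)
      then show "(?D i has_integral h i x) {0..1}"
        unfolding h_def by (intro integrable_integral integrable_continuous_real)
    qed
    ultimately have "f (?y 1) - f (?y 0) = (\<Sum>i\<in>Basis. ((x - a) \<bullet> i) * h i x)"
      by (rule has_integral_unique)
    then show ?thesis by simp
  qed
  ultimately show thesis by (rule that)
qed

section \<open>Local coordinates and derivations\<close>

definition chart_extension :: "'m set \<Rightarrow> ('m \<Rightarrow> 'e) \<Rightarrow> ('e \<Rightarrow> real) \<Rightarrow> 'm \<Rightarrow> real" where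
  "chart_extension U \<phi> h = (\<lambda>m. if m \<in> U then h (\<phi> m) else 0)"

text \<open>The coordinate derivation in direction \<open>i\<close>, cut off by \<open>b\<close> so
  that it becomes a global field. The value 0 on functions that are not smooth is the one prescribed
  by \<open>vector_fields\<close>.\<close>

definition coordinate_field ::
    "('m, 'e::euclidean_space) chart set \<Rightarrow> 'm set \<Rightarrow> ('m \<Rightarrow> 'e) \<Rightarrow> ('e \<Rightarrow> real) \<Rightarrow> 'e \<Rightarrow> 'm vfield" where
  "coordinate_field A U \<phi> b i = (\<lambda>f. if f \<in> smooth_functions A
     then chart_extension U \<phi> (\<lambda>x. b x * frechet_derivative (f \<circ> inv_into U \<phi>) (at x) i) else 0)"

text \<open>The space is covered by \<open>ball q t\<close>, where both factors are smooth, and the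
  complement of \<open>cball q s\<close>, where the product is zero. Values of \<open>h\<close>
  outside its ball are thus harmless.\<close>

lemma smooth_on_bump_mult:
  fixes h :: "'a::euclidean_space \<Rightarrow> real"
  assumes "smooth_on UNIV b" "\<And>x. x \<notin> ball q s \<Longrightarrow> b x = 0" "s < t" "smooth_on (ball q t) h"
  shows "smooth_on UNIV (\<lambda>x. b x * h x)"
proof (rule smooth_on_local)
  fix x
  show "\<exists>T. open T \<and> x \<in> T \<and> smooth_on T (\<lambda>x. b x * h x)"
  proof (cases "x \<in> ball q t")
    case True
    moreover have "smooth_on (ball q t) (\<lambda>x. b x * h x)"
      using assms by (intro smooth_on_mult smooth_on_subset[OF assms(1)]) auto
    ultimately show ?thesis using open_ball by blast
  next
    case False
    have op: "open (- cball q s)" by auto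
    have "smooth_on (- cball q s) (\<lambda>x. b x * h x)"
      by (rule smooth_on_cong[OF op _ smooth_on_const[OF op, of 0]]) (auto simp: assms(2))
    then show ?thesis using False op assms(3) by (intro exI[of _ "- cball q s"]) auto
  qed
qed

lemma sum_fun_apply: "sum f I x = (\<Sum>i\<in>I. f i x)"
  by (induction I rule: infinite_finite_induct) auto

lemma in_smooth_functionsI:
  "(\<And>U \<phi>. (U, \<phi>) \<in> A \<Longrightarrow> smooth_on (\<phi> ` U) (f \<circ> inv_into U \<phi>)) \<Longrightarrow> f \<in> smooth_functions A"
  by (auto simp: smooth_functions_def)

lemma in_smooth_functionsD:
  "f \<in> smooth_functions A \<Longrightarrow> (U, \<phi>) \<in> A \<Longrightarrow> smooth_on (\<phi> ` U) (f \<circ> inv_into U \<phi>)"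
  by (auto simp: smooth_functions_def)

section \<open>Charts, smooth functions, and the local form of derivations\<close>

locale smooth_manifold =
  fixes A :: "('m::t2_space, 'e::euclidean_space) chart set"
  assumes atlas: "smooth_atlas A"
begin

abbreviation "C \<equiv> smooth_functions A"
abbreviation "V \<equiv> vector_fields A"

lemma chart_cover: obtains U \<phi> where "(U, \<phi>) \<in> A" "m \<in> U"
proof -
  have "m \<in> (\<Union>(U, \<phi>)\<in>A. U)" using atlas by (simp add: smooth_atlas_def)
  then show ?thesis using that by auto
qed

lemma
  assumes "(U, \<phi>) \<in> A"
  shows chart_open: "open U" and chart_image_open: "open (\<phi> ` U)"
    and chart_homeomorphism: "homeomorphism U (\<phi> ` U) \<phi> (inv_into U \<phi>)"
  using assms atlas by (auto simp: smooth_atlas_def)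

lemma chart_inverse: "(U, \<phi>) \<in> A \<Longrightarrow> m \<in> U \<Longrightarrow> inv_into U \<phi> (\<phi> m) = m"
  using chart_homeomorphism by (auto simp: homeomorphism_def)

lemma chart_image_Int_open:
  assumes "(U, \<phi>) \<in> A" "open W"
  shows "open (\<phi> ` (U \<inter> W))"
proof -
  have "\<phi> ` (U \<inter> W) = \<phi> ` U \<inter> inv_into U \<phi> -` W"
    using chart_inverse[OF assms(1)] by force
  then show ?thesis
    using chart_homeomorphism[OF assms(1)] chart_image_open[OF assms(1)] assms(2)
    by (auto simp: homeomorphism_def intro!: continuous_open_preimage)
qed

lemma chart_transition:
  "(U, \<phi>) \<in> A \<Longrightarrow> (W, \<psi>) \<in> A \<Longrightarrow> smooth_on (\<phi> ` (U \<inter> W)) (\<psi> \<circ> inv_into U \<phi>)"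
  using atlas unfolding smooth_atlas_def by blast

text \<open>At a point of \<open>U\<close> the transition maps give smoothness. At any other point
  the extension vanishes nearby: the preimage of \<open>K\<close> is compact, hence closed in the
  Hausdorff space, and its complement is a neighbourhood free of the support. Closedness of
  \<open>K\<close> relative to the chart image would not suffice for this.\<close>

lemma chart_extension_smooth:
  assumes U: "(U, \<phi>) \<in> A" and h: "smooth_on (\<phi> ` U) h" and K: "compact K" "K \<subseteq> \<phi> ` U"
    and zero: "\<And>x. x \<in> \<phi> ` U - K \<Longrightarrow> h x = 0"
  shows "chart_extension U \<phi> h \<in> C"
proof (rule in_smooth_functionsI, rule smooth_on_local)
  fix W \<psi> y assume W: "(W, \<psi>) \<in> A" and "y \<in> \<psi> ` W"
  then obtain m where m: "m \<in> W" "y = \<psi> m" by auto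
  let ?F = "chart_extension U \<phi> h \<circ> inv_into W \<psi>"
  show "\<exists>T. open T \<and> y \<in> T \<and> smooth_on T ?F"
  proof (cases "m \<in> U")
    case True
    have op: "open (\<psi> ` (W \<inter> U))" using chart_image_Int_open[OF W chart_open[OF U]] .
    have "smooth_on (\<psi> ` (W \<inter> U)) (\<lambda>x. h ((\<phi> \<circ> inv_into W \<psi>) x))"
      by (rule smooth_on_compose[OF op chart_image_open[OF U] _ h chart_transition[OF W U]])
        (use chart_inverse[OF W] in auto)
    then have "smooth_on (\<psi> ` (W \<inter> U)) ?F"
      by (rule smooth_on_cong[OF op, rotated])
        (use chart_inverse[OF W] in \<open>auto simp: chart_extension_def\<close>)
    then show ?thesis using op True m by blast
  next
    case False
    have "compact (inv_into U \<phi> ` K)"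
      using chart_homeomorphism[OF U] K continuous_on_subset
      by (intro compact_continuous_image) (auto simp: homeomorphism_def)
    then have "open (- inv_into U \<phi> ` K)" by (simp add: compact_imp_closed open_Compl)
    then have op: "open (\<psi> ` (W \<inter> - inv_into U \<phi> ` K))" using chart_image_Int_open[OF W] by blast
    have "h (\<phi> x) = 0" if "x \<in> U" "x \<notin> inv_into U \<phi> ` K" for x
      using zero that chart_inverse[OF U that(1)] by (metis Diff_iff image_eqI)
    then have "smooth_on (\<psi> ` (W \<inter> - inv_into U \<phi> ` K)) ?F"
      by (intro smooth_on_cong[OF op _ smooth_on_const[OF op, of 0]])
        (use chart_inverse[OF W] in \<open>auto simp: chart_extension_def\<close>)
    moreover have "m \<notin> inv_into U \<phi> ` K"
      using False K(2) by (metis imageE inv_into_into subsetD)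
    ultimately show ?thesis using op m by blast
  qed
qed

lemma chart_extension_UNIV_smooth:
  assumes "(U, \<phi>) \<in> A" "smooth_on UNIV h" "cball q s \<subseteq> \<phi> ` U" "\<And>x. x \<notin> ball q s \<Longrightarrow> h x = 0"
  shows "chart_extension U \<phi> h \<in> C"
  by (rule chart_extension_smooth[OF assms(1) smooth_on_subset[OF assms(2) subset_UNIV]
        compact_cball assms(3)]) (use assms(4) in auto)

lemma smooth_const: "(\<lambda>_. c) \<in> C"
  by (rule in_smooth_functionsI) (simp add: o_def smooth_on_const chart_image_open)

lemma smooth_zero: "0 \<in> C"
  using smooth_const[of 0] by (simp add: zero_fun_def)

lemma smooth_add: "f \<in> C \<Longrightarrow> h \<in> C \<Longrightarrow> f + h \<in> C"
  by (rule in_smooth_functionsI)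
    (use smooth_on_add[OF chart_image_open in_smooth_functionsD in_smooth_functionsD] in
      \<open>fastforce simp: o_def plus_fun_def\<close>)

lemma smooth_mult: "f \<in> C \<Longrightarrow> h \<in> C \<Longrightarrow> f * h \<in> C"
  by (rule in_smooth_functionsI)
    (use smooth_on_mult[OF chart_image_open in_smooth_functionsD in_smooth_functionsD] in
      \<open>fastforce simp: o_def times_fun_def\<close>)

lemma smooth_uminus: "f \<in> C \<Longrightarrow> - f \<in> C"
  using smooth_mult[OF smooth_const[of "- 1"], of f] by (simp add: times_fun_def fun_Compl_def)

lemma smooth_diff: "f \<in> C \<Longrightarrow> h \<in> C \<Longrightarrow> f - h \<in> C"
  using smooth_add[OF _ smooth_uminus, of f h] by simp

lemma smooth_sum: "(\<And>i. i \<in> I \<Longrightarrow> f i \<in> C) \<Longrightarrow> sum f I \<in> C"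
  by (induction I rule: infinite_finite_induct) (auto intro: smooth_add smooth_zero)

lemma smooth_local_has_derivative:
  assumes "(U, \<phi>) \<in> A" "f \<in> C" "x \<in> \<phi> ` U"
  shows "((f \<circ> inv_into U \<phi>) has_derivative frechet_derivative (f \<circ> inv_into U \<phi>) (at x)) (at x)"
  using in_smooth_functionsD[OF assms(2,1)] assms(3) by (rule smooth_on_has_derivative)

lemma in_vector_fieldsD:
  assumes "X \<in> V"
  shows "f \<in> C \<Longrightarrow> X f \<in> C"
    and "f \<in> C \<Longrightarrow> h \<in> C \<Longrightarrow> X (f + h) = X f + X h"
    and "f \<in> C \<Longrightarrow> X (\<lambda>p. c * f p) = (\<lambda>p. c * X f p)"
    and "f \<in> C \<Longrightarrow> h \<in> C \<Longrightarrow> X (f * h) = f * X h + X f * h"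
    and "f \<notin> C \<Longrightarrow> X f = 0"
  using assms unfolding vector_fields_def by blast+

lemma vector_field_zero: "X \<in> V \<Longrightarrow> X 0 = 0"
  using in_vector_fieldsD(3)[of X 0 0] smooth_zero by (simp add: zero_fun_def)

lemma vector_field_sum:
  "X \<in> V \<Longrightarrow> (\<And>i. i \<in> I \<Longrightarrow> f i \<in> C) \<Longrightarrow> X (sum f I) = (\<Sum>i\<in>I. X (f i))"
  by (induction I rule: infinite_finite_induct)
    (auto simp: vector_field_zero in_vector_fieldsD(2) smooth_sum)

lemma coordinate_field_in_vector_fields:
  assumes U: "(U, \<phi>) \<in> A" and b: "smooth_on UNIV b" and sub: "cball q s \<subseteq> \<phi> ` U"
    and zero: "\<And>x. x \<notin> ball q s \<Longrightarrow> b x = 0"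
  shows "coordinate_field A U \<phi> b i \<in> V"
proof -
  let ?E = "coordinate_field A U \<phi> b i"
  let ?D = "\<lambda>f x. frechet_derivative (f \<circ> inv_into U \<phi>) (at x) i"
  have E: "?E f m = (if m \<in> U then b (\<phi> m) * ?D f (\<phi> m) else 0)" if "f \<in> C" for f m
    using that by (simp add: coordinate_field_def chart_extension_def)
  note d = smooth_local_has_derivative[OF U]
  have D: "?D f x = f' i" if "((f \<circ> inv_into U \<phi>) has_derivative f') (at x)" for f f' x
    using frechet_derivative_at[OF that] by simp
  have add: "?D (f + h) (\<phi> m) = ?D f (\<phi> m) + ?D h (\<phi> m)" if "f \<in> C" "h \<in> C" "m \<in> U" for f h m
  proof -
    have "((f + h) \<circ> inv_into U \<phi>) = (\<lambda>x. (f \<circ> inv_into U \<phi>) x + (h \<circ> inv_into U \<phi>) x)" by auto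
    then have "(((f + h) \<circ> inv_into U \<phi>) has_derivative
        (\<lambda>v. frechet_derivative (f \<circ> inv_into U \<phi>) (at (\<phi> m)) v
          + frechet_derivative (h \<circ> inv_into U \<phi>) (at (\<phi> m)) v)) (at (\<phi> m))"
      using has_derivative_add[OF d[OF that(1)] d[OF that(2)], of "\<phi> m"] that(3) by simp
    from D[OF this] show ?thesis .
  qed
  have scale: "?D (\<lambda>p. c * f p) (\<phi> m) = c * ?D f (\<phi> m)" if "f \<in> C" "m \<in> U" for c f m
  proof -
    have "((\<lambda>p. c * f p) \<circ> inv_into U \<phi>) = (\<lambda>x. c * (f \<circ> inv_into U \<phi>) x)" by auto
    then have "(((\<lambda>p. c * f p) \<circ> inv_into U \<phi>) has_derivative
        (\<lambda>v. c * frechet_derivative (f \<circ> inv_into U \<phi>) (at (\<phi> m)) v)) (at (\<phi> m))"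
      using has_derivative_mult_right[OF d[OF that(1)], of "\<phi> m" c] that(2) by simp
    from D[OF this] show ?thesis .
  qed
  have mult: "?D (f * h) (\<phi> m) = f m * ?D h (\<phi> m) + ?D f (\<phi> m) * h m"
    if "f \<in> C" "h \<in> C" "m \<in> U" for f h m
  proof -
    have "((f * h) \<circ> inv_into U \<phi>) = (\<lambda>x. (f \<circ> inv_into U \<phi>) x * (h \<circ> inv_into U \<phi>) x)" by auto
    then have "(((f * h) \<circ> inv_into U \<phi>) has_derivative
        (\<lambda>v. f m * frechet_derivative (h \<circ> inv_into U \<phi>) (at (\<phi> m)) v
          + frechet_derivative (f \<circ> inv_into U \<phi>) (at (\<phi> m)) v * h m)) (at (\<phi> m))"
      using has_derivative_mult[OF d[OF that(1)] d[OF that(2)], of "\<phi> m"] that(3)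
      by (simp add: chart_inverse[OF U])
    from D[OF this] show ?thesis .
  qed
  have smooth: "?E f \<in> C" if "f \<in> C" for f
    unfolding coordinate_field_def using that
  proof (simp, intro chart_extension_smooth[OF U, where K = "cball q s"])
    show "smooth_on (\<phi> ` U) (\<lambda>x. b x * ?D f x)"
      by (intro smooth_on_mult chart_image_open[OF U] smooth_on_subset[OF b]
          smooth_on_frechet_derivative in_smooth_functionsD[OF that U]) auto
  qed (use sub zero in auto)
  show ?thesis
    unfolding vector_fields_def
  proof (intro CollectI conjI ballI allI impI)
    fix f h c assume f: "f \<in> C"
    show "?E (\<lambda>p. c * f p) = (\<lambda>p. c * ?E f p)"
      using f smooth_mult[OF smooth_const[of c] f]
      by (auto simp: E scale times_fun_def)
    assume h: "h \<in> C"
    show "?E (f + h) = ?E f + ?E h"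
      using f h smooth_add[OF f h] by (auto simp: E add algebra_simps)
    show "?E (f * h) = f * ?E h + ?E f * h"
      using f h smooth_mult[OF f h] by (auto simp: E mult algebra_simps)
  qed (use smooth in \<open>auto simp: coordinate_field_def\<close>)
qed

text \<open>A derivation acts on global functions only, so Hadamard's formula around
  \<open>m\<close> is first globalized with a bump function. The product rule at \<open>m\<close>
  then isolates the linear terms. The \<open>v i\<close> are cut-off coordinates, chosen before
  \<open>X\<close> and \<open>f\<close>.\<close>

lemma vector_field_eq_partial_derivatives:
  assumes U: "(U, \<phi>) \<in> A" and m: "m \<in> U"
  shows "\<exists>v. (\<forall>i. v i \<in> C) \<and> (\<forall>X\<in>V. \<forall>f\<in>C. X f m =
    (\<Sum>i\<in>Basis. X (v i) m * frechet_derivative (f \<circ> inv_into U \<phi>) (at (\<phi> m)) i))"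
proof -
  let ?q = "\<phi> m"
  obtain t where t: "t > 0" "cball ?q t \<subseteq> \<phi> ` U"
    using chart_image_open[OF U] m open_contains_cball by blast
  define s where "s = t / 2"
  have s: "0 < s" "s < t" using t by (auto simp: s_def)
  obtain b :: "'e \<Rightarrow> real" where b: "smooth_on UNIV b" "\<forall>x\<in>cball ?q (s / 2). b x = 1"
    "\<And>x. x \<notin> ball ?q s \<Longrightarrow> b x = 0"
    using ex_smooth_bump[of "s / 2" s ?q] s by auto
  have ext: "chart_extension U \<phi> (\<lambda>x. b x * h x) \<in> C" if "smooth_on (ball ?q t) h" for h
  proof (rule chart_extension_UNIV_smooth[OF U smooth_on_bump_mult[OF b(1) b(3) s(2) that]])
    show "cball ?q t \<subseteq> \<phi> ` U" by (rule t)
  qed (use b(3) s in auto)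
  define \<beta> where "\<beta> = chart_extension U \<phi> b"
  define v where "v = (\<lambda>i. chart_extension U \<phi> (\<lambda>x. b x * ((x - ?q) \<bullet> i)))"
  have \<beta>: "\<beta> \<in> C" using ext[of "\<lambda>_. 1"] by (simp add: \<beta>_def smooth_on_const)
  have sm_id: "smooth_on (ball ?q t) (\<lambda>x. x)"
    by (simp add: smooth_on_bounded_linear bounded_linear_ident)
  have v: "v i \<in> C" for i
    unfolding v_def by (intro ext smooth_on_inner smooth_on_diff_const smooth_on_const sm_id open_ball)
  have at_m: "\<beta> m = 1" "v i m = 0" for i
    using b(2) m s by (auto simp: \<beta>_def v_def chart_extension_def)
  have "X f m = (\<Sum>i\<in>Basis. X (v i) m * frechet_derivative (f \<circ> inv_into U \<phi>) (at ?q) i)"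
    if X: "X \<in> V" and f: "f \<in> C" for X f
  proof -
    have "smooth_on (ball ?q t) (f \<circ> inv_into U \<phi>)"
      by (rule smooth_on_subset[OF in_smooth_functionsD[OF f U]]) (use t ball_subset_cball in blast)
    then obtain h where h: "\<And>i. smooth_on (ball ?q t) (h i)"
      "\<And>i. h i ?q = frechet_derivative (f \<circ> inv_into U \<phi>) (at ?q) i"
      "\<And>x. x \<in> ball ?q t \<Longrightarrow> (f \<circ> inv_into U \<phi>) x =
        (f \<circ> inv_into U \<phi>) ?q + (\<Sum>i\<in>Basis. ((x - ?q) \<bullet> i) * h i x)"
      by (rule hadamard) (rule that)
    define H where "H = (\<lambda>i. chart_extension U \<phi> (\<lambda>x. b x * h i x))"
    have H: "H i \<in> C" for i unfolding H_def by (rule ext[OF h(1)])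
    \<comment> \<open>The square of \<open>\<beta>\<close> appears because each of
      \<open>v i\<close> and \<open>H i\<close> carries one factor \<open>b\<close>. Under
      \<open>X\<close> at \<open>m\<close> the terms with \<open>X (\<beta> * \<beta>)\<close>
      cancel, and \<open>v i m = 0\<close> removes those with \<open>X (H i)\<close>.\<close>
    have eq: "(\<beta> * \<beta>) * f = (\<lambda>x. f m * (\<beta> * \<beta>) x) + (\<Sum>i\<in>Basis. v i * H i)"
    proof
      fix x
      show "((\<beta> * \<beta>) * f) x = ((\<lambda>x. f m * (\<beta> * \<beta>) x) + (\<Sum>i\<in>Basis. v i * H i)) x"
      proof (cases "x \<in> U \<and> b (\<phi> x) \<noteq> 0")
        case True
        then have "\<phi> x \<in> ball ?q t" using b(3)[of "\<phi> x"] s by force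
        from h(3)[OF this] have "f x = f m + (\<Sum>i\<in>Basis. ((\<phi> x - ?q) \<bullet> i) * h i (\<phi> x))"
          using True m chart_inverse[OF U] by auto
        then show ?thesis using True
          by (simp add: \<beta>_def v_def H_def chart_extension_def sum_distrib_left algebra_simps
              sum_fun_apply)
      qed (auto simp: \<beta>_def v_def H_def chart_extension_def sum_fun_apply)
    qed
    have \<beta>\<beta>: "\<beta> * \<beta> \<in> C" by (intro smooth_mult \<beta>)
    have c\<beta>: "(\<lambda>x. f m * (\<beta> * \<beta>) x) \<in> C"
      using smooth_mult[OF smooth_const \<beta>\<beta>] by (simp add: times_fun_def)
    have vH: "v i * H i \<in> C" for i by (intro smooth_mult v H)
    have "X ((\<beta> * \<beta>) * f) m = X f m + X (\<beta> * \<beta>) m * f m"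
      by (simp add: in_vector_fieldsD(4)[OF X \<beta>\<beta> f] at_m)
    moreover have "X ((\<beta> * \<beta>) * f) m = f m * X (\<beta> * \<beta>) m + (\<Sum>i\<in>Basis. X (v i) m * H i m)"
      unfolding eq in_vector_fieldsD(2)[OF X c\<beta> smooth_sum[OF vH]] in_vector_fieldsD(3)[OF X \<beta>\<beta>]
      by (simp add: vector_field_sum[OF X vH] in_vector_fieldsD(4)[OF X v H] sum_fun_apply at_m)
    moreover have "H i m = frechet_derivative (f \<circ> inv_into U \<phi>) (at ?q) i" for i
      using m b(2) s by (simp add: H_def chart_extension_def h(2))
    ultimately show ?thesis by simp
  qed
  then show ?thesis using v by blast
qed

text \<open>The values at \<open>p\<close> of \<open>C\<^sup>\<infinity>\<close>-linear forms, including those which are not known to be smooth.\<close>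

definition covector_at :: "'m \<Rightarrow> ('m vfield \<Rightarrow> real) \<Rightarrow> bool" where
  "covector_at p \<alpha> \<longleftrightarrow> (\<forall>X\<in>V. \<forall>Y\<in>V. \<alpha> (X + Y) = \<alpha> X + \<alpha> Y) \<and> (\<forall>h\<in>C. \<forall>X\<in>V. \<alpha> (h \<odot> X) = h p * \<alpha> X)"

section \<open>The module of vector fields, the Lie bracket, and a coordinate frame at a
  point\<close>

lemma vfield_add: "X \<in> V \<Longrightarrow> Y \<in> V \<Longrightarrow> X + Y \<in> V"
  by (auto simp: vector_fields_def smooth_add fun_eq_iff algebra_simps)

lemma vfield_scale: "h \<in> C \<Longrightarrow> X \<in> V \<Longrightarrow> h \<odot> X \<in> V"
  by (auto simp: vector_fields_def vscale_def smooth_mult fun_eq_iff algebra_simps)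

lemma vfield_zero: "0 \<in> V"
  by (auto simp: vector_fields_def smooth_zero fun_eq_iff)

lemma vfield_uminus: "X \<in> V \<Longrightarrow> - X \<in> V"
  by (auto simp: vector_fields_def smooth_uminus fun_eq_iff algebra_simps)

lemma vfield_diff: "X \<in> V \<Longrightarrow> Y \<in> V \<Longrightarrow> X - Y \<in> V"
  using vfield_add[OF _ vfield_uminus, of X Y] by simp

lemma vfield_sum: "(\<And>i. i \<in> I \<Longrightarrow> X i \<in> V) \<Longrightarrow> sum X I \<in> V"
  by (induction I rule: infinite_finite_induct) (auto intro: vfield_add vfield_zero)

lemma lie_bracket_in_vector_fields:
  assumes X: "X \<in> V" and Y: "Y \<in> V"
  shows "lie_bracket X Y \<in> V"
  unfolding vector_fields_def
proof (intro CollectI conjI ballI allI impI)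
  note D = in_vector_fieldsD[OF X] in_vector_fieldsD[OF Y]
  fix f assume "f \<notin> C"
  then show "lie_bracket X Y f = 0" by (simp add: lie_bracket_def D vector_field_zero X Y)
next
  note D = in_vector_fieldsD[OF X] in_vector_fieldsD[OF Y]
  fix f c assume f: "f \<in> C"
  then show "lie_bracket X Y f \<in> C" by (simp add: lie_bracket_def D smooth_diff)
  show "lie_bracket X Y (\<lambda>p. c * f p) = (\<lambda>p. c * lie_bracket X Y f p)"
    using f by (simp add: lie_bracket_def D fun_eq_iff algebra_simps)
  fix h assume h: "h \<in> C"
  show "lie_bracket X Y (f + h) = lie_bracket X Y f + lie_bracket X Y h"
    using f h by (simp add: lie_bracket_def D)
  show "lie_bracket X Y (f * h) = f * lie_bracket X Y h + lie_bracket X Y f * h"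
    using f h by (simp add: lie_bracket_def D smooth_mult algebra_simps)
qed

lemma covector_atD:
  assumes "covector_at p \<alpha>"
  shows "X \<in> V \<Longrightarrow> Y \<in> V \<Longrightarrow> \<alpha> (X + Y) = \<alpha> X + \<alpha> Y"
    and "h \<in> C \<Longrightarrow> X \<in> V \<Longrightarrow> \<alpha> (h \<odot> X) = h p * \<alpha> X"
  using assms by (auto simp: covector_at_def)

lemma covector_at_sum:
  assumes "covector_at p \<alpha>" "\<And>i. i \<in> I \<Longrightarrow> X i \<in> V"
  shows "\<alpha> (sum X I) = (\<Sum>i\<in>I. \<alpha> (X i))"
proof -
  have "0 \<odot> (0 :: 'm vfield) = 0" by (simp add: vscale_def fun_eq_iff)
  then have "\<alpha> 0 = 0"
    using covector_atD(2)[OF assms(1) smooth_zero vfield_zero] by simp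
  then show ?thesis using assms(2)
    by (induction I rule: infinite_finite_induct)
      (auto simp: covector_atD(1)[OF assms(1)] vfield_sum)
qed

text \<open>Two nested cutoffs are used. The fields \<open>E i\<close> and the factor
  \<open>\<zeta>\<close> live where \<open>b\<close> does, and \<open>d\<close> equals 1 there, so
  the functions \<open>u i\<close> are genuine coordinates, up to translation, on that whole region.
  Hence \<open>\<zeta> \<odot> X\<close> is globally the combination of the \<open>E i\<close> with
  coefficients \<open>X (u i)\<close>, an identity to which \<open>\<alpha>\<close> can be applied;
  \<open>\<zeta> p = 1\<close> removes the cutoff.\<close>

lemma coordinate_frame:
  obtains E :: "'e \<Rightarrow> 'm vfield" and u where "\<And>i. E i \<in> V" "\<And>i. u i \<in> C"
    "\<And>i j. i \<in> Basis \<Longrightarrow> j \<in> Basis \<Longrightarrow> E i (u j) p = (if i = j then 1 else 0)"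
    "\<And>\<alpha> X. covector_at p \<alpha> \<Longrightarrow> X \<in> V \<Longrightarrow> \<alpha> X = (\<Sum>i\<in>Basis. X (u i) p * \<alpha> (E i))"
proof -
  obtain U \<phi> where U: "(U, \<phi>) \<in> A" and p: "p \<in> U" by (rule chart_cover)
  let ?q = "\<phi> p"
  let ?D = "\<lambda>f x i. frechet_derivative (f \<circ> inv_into U \<phi>) (at x) i"
  obtain t where t: "t > 0" "cball ?q t \<subseteq> \<phi> ` U"
    using chart_image_open[OF U] p open_contains_cball by blast
  obtain b :: "'e \<Rightarrow> real" where b: "smooth_on UNIV b" "\<And>x. x \<in> cball ?q (t / 4) \<Longrightarrow> b x = 1"
    "\<And>x. x \<notin> ball ?q (t / 2) \<Longrightarrow> b x = 0"
    using ex_smooth_bump[of "t / 4" "t / 2" ?q] t by auto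
  obtain d :: "'e \<Rightarrow> real" where d: "smooth_on UNIV d" "\<And>x. x \<in> cball ?q (t / 2) \<Longrightarrow> d x = 1"
    "\<And>x. x \<notin> ball ?q t \<Longrightarrow> d x = 0"
    using ex_smooth_bump[of "t / 2" t ?q] t by auto
  define E where "E = coordinate_field A U \<phi> b"
  define \<zeta> where "\<zeta> = chart_extension U \<phi> b"
  define u where "u = (\<lambda>i. chart_extension U \<phi> (\<lambda>x. d x * ((x - ?q) \<bullet> i)))"
  have sm_id: "smooth_on UNIV (\<lambda>x::'e. x)"
    by (simp add: smooth_on_bounded_linear bounded_linear_ident)
  have sub: "cball ?q (t / 2) \<subseteq> \<phi> ` U" 
    using subset_cball[of "t / 2" t ?q] t by auto
  have E: "E i \<in> V" for i
    unfolding E_def by (rule coordinate_field_in_vector_fields[OF U b(1) sub b(3)])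
  have \<zeta>: "\<zeta> \<in> C"
    unfolding \<zeta>_def by (rule chart_extension_UNIV_smooth[OF U b(1) sub b(3)])
  have u: "u i \<in> C" for i
    unfolding u_def
    by (rule chart_extension_UNIV_smooth[OF U _ t(2)])
      (auto simp: d(3) intro!: smooth_on_mult d smooth_on_inner smooth_on_diff_const sm_id smooth_on_const)
  have Du: "?D (u j) x i = i \<bullet> j" if "x \<in> ball ?q (t / 2)" for i j x
  proof -
    have "((\<lambda>x. (x - ?q) \<bullet> j) has_derivative (\<lambda>v. v \<bullet> j)) (at x)"
      by (auto intro!: derivative_eq_intros)
    then have "((u j \<circ> inv_into U \<phi>) has_derivative (\<lambda>v. v \<bullet> j)) (at x)"
    proof (rule has_derivative_transform_within_open[OF _ open_ball that])
      fix y assume y: "y \<in> ball ?q (t / 2)"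
      then have "y \<in> \<phi> ` U" using sub ball_subset_cball by blast
      then show "(y - ?q) \<bullet> j = (u j \<circ> inv_into U \<phi>) y"
        using y d(2)[of y] chart_inverse[OF U] by (auto simp: u_def chart_extension_def)
    qed
    then show ?thesis using frechet_derivative_at by metis
  qed
  have at_m: "X f m = (\<Sum>i\<in>Basis. X (u i) m * ?D f (\<phi> m) i)"
    if X: "X \<in> V" and f: "f \<in> C" and m: "m \<in> U" "\<phi> m \<in> ball ?q (t / 2)" for X f m
  proof -
    obtain v where v: "\<And>X f. X \<in> V \<Longrightarrow> f \<in> C \<Longrightarrow> X f m = (\<Sum>i\<in>Basis. X (v i) m * ?D f (\<phi> m) i)"
      using vector_field_eq_partial_derivatives[OF U m(1)] by blast
    \<comment> \<open>The functions \<open>v\<close> depend on the point \<open>m\<close>. Applying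
      their formula to \<open>u j\<close> itself exchanges them for functions that serve all points
      of the ball.\<close>
    have "X (u j) m = X (v j) m" if "j \<in> Basis" for j
    proof -
      have "X (u j) m = (\<Sum>i\<in>Basis. if i = j then X (v j) m else 0)"
        unfolding v[OF X u] by (intro sum.cong) (use that in \<open>auto simp: Du[OF m(2)] inner_Basis\<close>)
      then show ?thesis using that by simp
    qed
    then show ?thesis unfolding v[OF X f] by (intro sum.cong) auto
  qed
  have span: "\<zeta> \<odot> X = (\<Sum>i\<in>Basis. X (u i) \<odot> E i)" if X: "X \<in> V" for X
  proof (intro ext)
    fix f m
    show "(\<zeta> \<odot> X) f m = (\<Sum>i\<in>Basis. X (u i) \<odot> E i) f m"
    proof (cases "f \<in> C")
      case True
      show ?thesis
      proof (cases "m \<in> U \<and> \<phi> m \<in> ball ?q (t / 2)")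
        case in_ball: True
        then have "X f m = (\<Sum>i\<in>Basis. X (u i) m * ?D f (\<phi> m) i)" using at_m X True by blast
        then show ?thesis using in_ball True
          by (simp add: vscale_def sum_fun_apply \<zeta>_def E_def coordinate_field_def
              chart_extension_def sum_distrib_left algebra_simps)
      next
        case False
        then show ?thesis using True b(3)
          by (auto simp: vscale_def sum_fun_apply \<zeta>_def E_def coordinate_field_def chart_extension_def)
      qed
    next
      case False
      then show ?thesis
        using in_vector_fieldsD(5)[OF X False] in_vector_fieldsD(5)[OF E False]
        by (simp add: vscale_def sum_fun_apply)
    qed
  qed
  have \<zeta>p: "\<zeta> p = 1" using p t b(2) by (simp add: \<zeta>_def chart_extension_def)
  show ?thesis
  proof
    show "E i (u j) p = (if i = j then 1 else 0)" if "i \<in> Basis" "j \<in> Basis" for i j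
      using that u Du[of ?q] t p b(2)
      by (simp add: E_def coordinate_field_def chart_extension_def inner_Basis)
    show "\<alpha> X = (\<Sum>i\<in>Basis. X (u i) p * \<alpha> (E i))" if \<alpha>: "covector_at p \<alpha>" and X: "X \<in> V" for \<alpha> X
    proof -
      have "\<alpha> X = \<alpha> (\<zeta> \<odot> X)" using \<alpha> X \<zeta> \<zeta>p by (simp add: covector_at_def)
      also have "\<dots> = (\<Sum>i\<in>Basis. \<alpha> (X (u i) \<odot> E i))"
        unfolding span[OF X]
        by (rule covector_at_sum[OF \<alpha> vfield_scale[OF in_vector_fieldsD(1)[OF X u] E]])
      also have "\<dots> = (\<Sum>i\<in>Basis. X (u i) p * \<alpha> (E i))"
        by (simp add: covector_atD(2)[OF \<alpha> in_vector_fieldsD(1)[OF X u] E])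
      finally show ?thesis .
    qed
  qed (use E u in auto)
qed

end

section \<open>Traces at a point\<close>

lemma linear_matrix:
  fixes a :: "'a::euclidean_space \<Rightarrow> 'b::real_inner \<Rightarrow> real"
  shows "linear (\<lambda>x. \<Sum>i\<in>S. (\<Sum>j\<in>T. (x \<bullet> j) * a i j) *\<^sub>R i)"
  by (rule linearI)
    (simp_all add: inner_add_left distrib_right sum.distrib scaleR_left_distrib scaleR_sum_right
      sum_distrib_left mult.assoc)

context smooth_manifold
begin

lemma covector_at_cong:
  "(\<And>X. X \<in> V \<Longrightarrow> \<alpha> X = \<beta> X) \<Longrightarrow> covector_at p \<beta> \<Longrightarrow> covector_at p \<alpha>"
  by (simp add: covector_at_def vfield_add vfield_scale)

lemma covector_at_one_form: "one_form A \<alpha> \<Longrightarrow> covector_at p (\<lambda>X. \<alpha> X p)"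
  by (auto simp: one_form_def covector_at_def)

lemma covector_at_apply: "f \<in> C \<Longrightarrow> covector_at p (\<lambda>X. X f p)"
  by (auto simp: covector_at_def vscale_def)

lemma covector_at_add: "covector_at p \<alpha> \<Longrightarrow> covector_at p \<beta> \<Longrightarrow> covector_at p (\<lambda>X. \<alpha> X + \<beta> X)"
  and covector_at_mult: "covector_at p \<alpha> \<Longrightarrow> covector_at p (\<lambda>X. c * \<alpha> X)"
  by (auto simp: covector_at_def algebra_simps)

lemma covector_at_uminus: "covector_at p \<alpha> \<Longrightarrow> covector_at p (\<lambda>X. - \<alpha> X)"
  using covector_at_mult[of p \<alpha> "- 1"] by simp

lemma covector_at_diff: "covector_at p \<alpha> \<Longrightarrow> covector_at p \<beta> \<Longrightarrow> covector_at p (\<lambda>X. \<alpha> X - \<beta> X)"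
  using covector_at_add[OF _ covector_at_uminus] by simp

lemma covector_at_sum_pointwise:
  "(\<And>i. i \<in> I \<Longrightarrow> covector_at p (\<alpha> i)) \<Longrightarrow> covector_at p (\<lambda>X. \<Sum>i\<in>I. \<alpha> i X)"
  by (simp add: covector_at_def sum.distrib sum_distrib_left)

lemma covector_at_endomorphism:
  "endomorphism_field A F \<Longrightarrow> covector_at p \<alpha> \<Longrightarrow> covector_at p (\<lambda>X. \<alpha> (F X))"
  by (auto simp: endomorphism_field_def covector_at_def)

text \<open>Duality at \<open>p\<close> says that one matrix product is the identity:
  \<open>M\<close> after \<open>L\<close>, with the entries of \<open>\<theta>\<close> and
  \<open>F\<close> taken in the coordinate frame. The frame has exactly \<open>DIM('e)\<close>
  members, so the matrices are square and the reverse product is the identity too; this is the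
  completeness relation that makes \<open>F\<close> span.\<close>

lemma dual_frame_expansion:
  assumes dual: "dual_frames_at A p F \<theta>" and \<alpha>: "covector_at p \<alpha>" and X: "X \<in> V"
  shows "\<alpha> X = (\<Sum>i\<in>Basis. \<theta> i X p * \<alpha> (F i))"
proof -
  obtain E :: "'e \<Rightarrow> 'm vfield" and u where E: "\<And>i. E i \<in> V" "\<And>i. u i \<in> C"
    and Eu: "\<And>i j. i \<in> Basis \<Longrightarrow> j \<in> Basis \<Longrightarrow> E i (u j) p = (if i = j then 1 else 0)"
    and exp: "\<And>\<alpha> X. covector_at p \<alpha> \<Longrightarrow> X \<in> V \<Longrightarrow> \<alpha> X = (\<Sum>i\<in>Basis. X (u i) p * \<alpha> (E i))"
    by (rule coordinate_frame[of p]) (rule that)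
  have F: "F i \<in> V" "one_form A (\<theta> i)" if "i \<in> Basis" for i
    using dual that by (auto simp: dual_frames_at_def)
  have \<theta>F: "\<theta> i (F j) p = (if i = j then 1 else 0)" if "i \<in> Basis" "j \<in> Basis" for i j
    using dual that by (auto simp: dual_frames_at_def)
  define L M :: "'e \<Rightarrow> 'e" where
    "L = (\<lambda>x. \<Sum>j\<in>Basis. (\<Sum>i\<in>Basis. (x \<bullet> i) * F i (u j) p) *\<^sub>R j)" and
    "M = (\<lambda>y. \<Sum>i\<in>Basis. (\<Sum>j\<in>Basis. (y \<bullet> j) * \<theta> i (E j) p) *\<^sub>R i)"
  have "linear L" "linear M"
    unfolding L_def M_def by (rule linear_matrix)+
  have L: "L x \<bullet> j = (\<Sum>i\<in>Basis. (x \<bullet> i) * F i (u j) p)" if "j \<in> Basis" for x j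
    using that by (simp add: L_def inner_sum_left inner_Basis if_distrib[of "(*) _"] cong: if_cong)
  have M: "M y \<bullet> i = (\<Sum>j\<in>Basis. (y \<bullet> j) * \<theta> i (E j) p)" if "i \<in> Basis" for y i
    using that by (simp add: M_def inner_sum_left inner_Basis if_distrib[of "(*) _"] cong: if_cong)
  have "M \<circ> L = id"
  proof
    fix x
    have "M (L x) \<bullet> i = x \<bullet> i" if i: "i \<in> Basis" for i
    proof -
      have "M (L x) \<bullet> i = (\<Sum>j\<in>Basis. \<Sum>k\<in>Basis. (x \<bullet> k) * (F k (u j) p * \<theta> i (E j) p))"
        using i by (simp add: M L sum_distrib_right mult.assoc)
      also have "\<dots> = (\<Sum>k\<in>Basis. (x \<bullet> k) * (\<Sum>j\<in>Basis. F k (u j) p * \<theta> i (E j) p))"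
        unfolding sum_distrib_left by (rule sum.swap)
      also have "\<dots> = (\<Sum>k\<in>Basis. (x \<bullet> k) * \<theta> i (F k) p)"
        using exp[OF covector_at_one_form[OF F(2)[OF i]] F(1)] by simp
      also have "\<dots> = x \<bullet> i" using i by (simp add: \<theta>F if_distrib[of "(*) _"] cong: if_cong)
      finally show ?thesis .
    qed
    then show "(M \<circ> L) x = id x" by (auto intro: euclidean_eqI)
  qed
  then have "L \<circ> M = id"
    using linear_inverse_left[OF \<open>linear L\<close> \<open>linear M\<close>] by simp
  then have LM: "L (M y) = y" for y by (simp add: fun_eq_iff)
  have inv: "(\<Sum>i\<in>Basis. \<theta> i (E k) p * F i (u j) p) = (if j = k then 1 else 0)"
    if "j \<in> Basis" "k \<in> Basis" for j k
  proof -
    have "M k \<bullet> i = \<theta> i (E k) p" if "i \<in> Basis" for i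
      using that \<open>k \<in> Basis\<close> by (simp add: M inner_Basis if_distrib[of "\<lambda>x. x * _"] cong: if_cong)
    then have "(\<Sum>i\<in>Basis. \<theta> i (E k) p * F i (u j) p) = L (M k) \<bullet> j"
      using that by (simp add: L)
    then show ?thesis using that by (simp add: LM inner_Basis)
  qed
  have "(\<Sum>i\<in>Basis. \<theta> i X p * \<alpha> (F i)) =
      (\<Sum>i\<in>Basis. (\<Sum>k\<in>Basis. X (u k) p * \<theta> i (E k) p) * (\<Sum>j\<in>Basis. F i (u j) p * \<alpha> (E j)))"
    using exp[OF covector_at_one_form[OF F(2)] X] exp[OF \<alpha> F(1)] by simp
  also have "\<dots> = (\<Sum>i\<in>Basis. \<Sum>k\<in>Basis. \<Sum>j\<in>Basis.
      X (u k) p * (\<theta> i (E k) p * F i (u j) p) * \<alpha> (E j))"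
    unfolding sum_product by (simp only: mult_ac)
  also have "\<dots> = (\<Sum>k\<in>Basis. \<Sum>i\<in>Basis. \<Sum>j\<in>Basis.
      X (u k) p * (\<theta> i (E k) p * F i (u j) p) * \<alpha> (E j))"
    by (rule sum.swap)
  also have "\<dots> = (\<Sum>k\<in>Basis. \<Sum>j\<in>Basis. \<Sum>i\<in>Basis.
      X (u k) p * (\<theta> i (E k) p * F i (u j) p) * \<alpha> (E j))"
    by (rule sum.cong[OF refl sum.swap])
  also have "\<dots> = (\<Sum>k\<in>Basis. \<Sum>j\<in>Basis.
      X (u k) p * (\<Sum>i\<in>Basis. \<theta> i (E k) p * F i (u j) p) * \<alpha> (E j))"
    by (simp add: sum_distrib_left sum_distrib_right)
  also have "\<dots> = (\<Sum>k\<in>Basis. \<Sum>j\<in>Basis. if j = k then X (u k) p * \<alpha> (E j) else 0)"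
    by (intro sum.cong refl) (simp add: inv)
  also have "\<dots> = (\<Sum>k\<in>Basis. X (u k) p * \<alpha> (E k))" by simp
  also have "\<dots> = \<alpha> X" using exp[OF \<alpha> X] by simp
  finally show ?thesis by simp
qed

text \<open>Invariance of the trace: expand the argument \<open>E' i\<close> in the first frame,
  swap the sums, and recognize the expansion of \<open>F (E j)\<close> in the second frame.\<close>

lemma field_trace_eq:
  assumes F: "endomorphism_field A F" and dual: "dual_frames_at A p E \<theta>"
  shows "field_trace A F p = (\<Sum>i\<in>Basis. \<theta> i (F (E i)) p)"
  unfolding field_trace_def
proof (rule the_equality)
  fix t assume "\<exists>E \<theta>. dual_frames_at A p E \<theta> \<and> t = (\<Sum>i\<in>Basis. \<theta> i (F (E i)) p)"
  then obtain E' \<theta>' where dual': "dual_frames_at A p E' \<theta>'"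
    and t: "t = (\<Sum>i\<in>Basis. \<theta>' i (F (E' i)) p)" by blast
  have E: "E i \<in> V" "E' i \<in> V" "one_form A (\<theta> i)" "one_form A (\<theta>' i)" if "i \<in> Basis" for i
    using that dual dual' by (auto simp: dual_frames_at_def)
  have FV: "X \<in> V \<Longrightarrow> F X \<in> V" for X using F by (auto simp: endomorphism_field_def)
  have "t = (\<Sum>i\<in>Basis. \<Sum>j\<in>Basis. \<theta> j (E' i) p * \<theta>' i (F (E j)) p)"
    unfolding t by (intro sum.cong refl dual_frame_expansion[OF dual] covector_at_endomorphism[OF F]
        covector_at_one_form E)
  also have "\<dots> = (\<Sum>j\<in>Basis. \<Sum>i\<in>Basis. \<theta>' i (F (E j)) p * \<theta> j (E' i) p)"
    by (subst sum.swap) (simp add: mult.commute)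
  also have "\<dots> = (\<Sum>j\<in>Basis. \<theta> j (F (E j)) p)"
    by (intro sum.cong refl dual_frame_expansion[OF dual', symmetric] covector_at_one_form E FV)
  finally show "t = (\<Sum>j\<in>Basis. \<theta> j (F (E j)) p)" .
qed (use dual in blast)

end

section \<open>Orthonormal frames and metric traces\<close>

locale riemannian_manifold = smooth_manifold A
  for A :: "('m::t2_space, 'e::euclidean_space) chart set" +
  fixes g :: "'m tensor2"
  assumes metric: "riemannian_metric A g"
begin

lemma metric_one_form: "X \<in> V \<Longrightarrow> one_form A (g X)"
  and metric_commute: "X \<in> V \<Longrightarrow> Y \<in> V \<Longrightarrow> g X Y = g Y X"
  and metric_pos: "X \<in> V \<Longrightarrow> value_at X p \<noteq> 0 \<Longrightarrow> g X X p > 0"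
  using metric by (auto simp: riemannian_metric_def)

lemma metric_covector: "X \<in> V \<Longrightarrow> covector_at p (\<lambda>Y. g X Y p)"
  by (intro covector_at_one_form metric_one_form)

lemma metric_covector_left: "Y \<in> V \<Longrightarrow> covector_at p (\<lambda>X. g X Y p)"
  using metric_covector[of Y p] vfield_add vfield_scale
  by (auto simp: covector_at_def metric_commute[of _ Y])

lemma orthonormal_dual_frames: "orthonormal_frame_at A g p E \<Longrightarrow> dual_frames_at A p E (\<lambda>i. g (E i))"
  by (auto simp: orthonormal_frame_at_def dual_frames_at_def metric_one_form)

lemmas orthonormal_expansion = dual_frame_expansion[OF orthonormal_dual_frames]

text \<open>Induction over subsets of the index basis, with a dimension count for the next vector.
  The map \<open>L\<close> sends coefficients \<open>x\<close> to the products of the combination of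
  the \<open>D j\<close> with the vectors found so far. Its range misses the new index
  \<open>k\<close>, so it has a kernel vector, and this yields a field \<open>W\<close> orthogonal
  to all of them at \<open>p\<close>. The coordinates \<open>u j\<close> detect that
  \<open>W\<close> does not vanish at \<open>p\<close>, whence it can be normalized.\<close>

lemma ex_orthonormal_frame: "\<exists>E. orthonormal_frame_at A g p E"
proof -
  obtain D :: "'e \<Rightarrow> 'm vfield" and u where D: "\<And>i. D i \<in> V" "\<And>i. u i \<in> C"
    and Du: "\<And>i j. i \<in> Basis \<Longrightarrow> j \<in> Basis \<Longrightarrow> D i (u j) p = (if i = j then 1 else 0)"
    by (rule coordinate_frame[of p]) (rule that)
  have "\<exists>E. \<forall>i\<in>S. E i \<in> V \<and> (\<forall>j\<in>S. g (E i) (E j) p = (if i = j then 1 else 0))"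
    if "finite S" "S \<subseteq> Basis" for S :: "'e set"
    using that
  proof (induction S rule: finite_induct)
    case (insert k S)
    then obtain E where E: "\<And>i. i \<in> S \<Longrightarrow> E i \<in> V"
      and EE: "\<And>i j. i \<in> S \<Longrightarrow> j \<in> S \<Longrightarrow> g (E i) (E j) p = (if i = j then 1 else 0)"
      by auto
    define L :: "'e \<Rightarrow> 'e" where "L = (\<lambda>x. \<Sum>i\<in>S. (\<Sum>j\<in>Basis. (x \<bullet> j) * g (E i) (D j) p) *\<^sub>R i)"
    have lin: "linear L"
      unfolding L_def by (rule linear_matrix)
    have L: "L x \<bullet> l = (if l \<in> S then \<Sum>j\<in>Basis. (x \<bullet> j) * g (E l) (D j) p else 0)"
      if "l \<in> Basis" for x l
    proof -
      have "L x \<bullet> l = (\<Sum>i\<in>S. if i = l then \<Sum>j\<in>Basis. (x \<bullet> j) * g (E i) (D j) p else 0)"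
        unfolding L_def inner_sum_left
        by (intro sum.cong) (use that insert.prems in \<open>auto simp: inner_Basis\<close>)
      then show ?thesis using insert.hyps by simp
    qed
    have "k \<notin> range L"
    proof
      assume "k \<in> range L"
      then obtain x where "L x = k" by blast
      moreover have "k \<in> Basis" using insert.prems by simp
      ultimately show False using L[of k x] insert.hyps by simp
    qed
    then have "\<not> inj L" using linear_injective_imp_surjective[OF lin] by auto
    then obtain x where x: "x \<noteq> 0" "L x = 0" using linear_injective_0[OF lin] by auto
    define W where "W = (\<Sum>j\<in>Basis. (\<lambda>_. x \<bullet> j) \<odot> D j)"
    have W: "W \<in> V" unfolding W_def by (intro vfield_sum vfield_scale smooth_const D)
    have \<alpha>W: "\<alpha> W = (\<Sum>j\<in>Basis. (x \<bullet> j) * \<alpha> (D j))" if "covector_at p \<alpha>" for \<alpha>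
      unfolding W_def
      by (simp add: covector_at_sum[OF that] covector_atD(2)[OF that] vfield_scale smooth_const D)
    obtain j where j: "j \<in> Basis" "x \<bullet> j \<noteq> 0" using x(1) euclidean_all_zero_iff by blast
    have "W (u j) p = x \<bullet> j"
      using j \<alpha>W[OF covector_at_apply[OF D(2)]] by (simp add: Du if_distrib[of "(*) _"] cong: if_cong)
    then have "value_at W p (u j) \<noteq> 0" using j by (simp add: value_at_def)
    then have "value_at W p \<noteq> 0" by fastforce
    then have pos: "g W W p > 0" using metric_pos W by blast
    have orth: "g (E i) W p = 0" if "i \<in> S" for i
    proof -
      have "i \<in> Basis" using that insert.prems by auto
      then show ?thesis
        using \<alpha>W[OF metric_covector[OF E[OF that]]] L[of i x] x(2) that by simp
    qed
    define c where "c = 1 / sqrt (g W W p)"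
    define Z where "Z = (\<lambda>_. c) \<odot> W"
    have Z: "Z \<in> V" unfolding Z_def by (intro vfield_scale smooth_const W)
    have gZ: "g Y Z p = c * g Y W p" if "Y \<in> V" for Y
      unfolding Z_def using covector_atD(2)[OF metric_covector[OF that] smooth_const W] .
    have EZ: "g (E i) Z p = 0" "g Z (E i) p = 0" if "i \<in> S" for i
      using gZ[OF E[OF that]] orth[OF that] metric_commute[OF E[OF that] Z] by simp_all
    have "g Z Z p = c * (c * g W W p)"
      using gZ[OF Z] gZ[OF W] metric_commute[OF Z W] by simp
    then have "g Z Z p = 1" using pos by (simp add: c_def)
    then show ?case
      using E EE EZ Z insert.hyps(2) by (intro exI[of _ "E(k := Z)"]) auto
  qed simp
  then show ?thesis unfolding orthonormal_frame_at_def by (metis finite_Basis order_refl)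
qed

text \<open>The argument of \<open>field_trace_eq\<close>: one frame is expanded in the first slot
  of \<open>h\<close>, and the second slot reassembles the other. Only bilinearity at
  \<open>p\<close> enters, so this covers tensors that are themselves defined by traces.\<close>

lemma metric_trace_eq:
  assumes h: "\<And>Y. Y \<in> V \<Longrightarrow> covector_at p (\<lambda>X. h X Y p)" "\<And>X. X \<in> V \<Longrightarrow> covector_at p (\<lambda>Y. h X Y p)"
    and on: "orthonormal_frame_at A g p E"
  shows "metric_trace A g h p = (\<Sum>i\<in>Basis. h (E i) (E i) p)"
  unfolding metric_trace_def
proof (rule the_equality)
  fix t assume "\<exists>E. orthonormal_frame_at A g p E \<and> t = (\<Sum>i\<in>Basis. h (E i) (E i) p)"
  then obtain E' where on': "orthonormal_frame_at A g p E'"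
    and t: "t = (\<Sum>i\<in>Basis. h (E' i) (E' i) p)" by blast
  have E: "E i \<in> V" "E' i \<in> V" if "i \<in> Basis" for i
    using that on on' by (auto simp: orthonormal_frame_at_def)
  have "t = (\<Sum>i\<in>Basis. \<Sum>j\<in>Basis. g (E j) (E' i) p * h (E j) (E' i) p)"
    unfolding t by (intro sum.cong refl orthonormal_expansion[OF on] h E)
  also have "\<dots> = (\<Sum>j\<in>Basis. \<Sum>i\<in>Basis. g (E' i) (E j) p * h (E j) (E' i) p)"
    by (subst sum.swap) (simp add: E metric_commute)
  also have "\<dots> = (\<Sum>j\<in>Basis. h (E j) (E j) p)"
    by (intro sum.cong refl orthonormal_expansion[OF on', symmetric] h E)
  finally show "t = (\<Sum>j\<in>Basis. h (E j) (E j) p)" .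
qed (use on in blast)

end

section \<open>The curvature of a Kenmotsu manifold\<close>

context smooth_manifold
begin

text \<open>Holds for every \<open>f\<close>, since a vector field takes the value 0 outside the
  smooth functions.\<close>

lemma vfield_apply_smooth: "X \<in> V \<Longrightarrow> X f \<in> C"
  using in_vector_fieldsD(1,5)[of X f] smooth_zero by metis

lemma additive_on_vfields:
  fixes F :: "'m vfield \<Rightarrow> 'b::ab_group_add"
  assumes add: "\<And>X Y. X \<in> V \<Longrightarrow> Y \<in> V \<Longrightarrow> F (X + Y) = F X + F Y"
  shows "F 0 = 0" "X \<in> V \<Longrightarrow> F (- X) = - F X" "X \<in> V \<Longrightarrow> Y \<in> V \<Longrightarrow> F (X - Y) = F X - F Y"
proof -
  show zero: "F 0 = 0" using add[OF vfield_zero vfield_zero] by simp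
  have minus: "F (- X) = - F X" if "X \<in> V" for X
    using add[OF that vfield_uminus[OF that]] zero by (simp add: eq_neg_iff_add_eq_0 add.commute)
  then show "X \<in> V \<Longrightarrow> F (- X) = - F X" .
  show "X \<in> V \<Longrightarrow> Y \<in> V \<Longrightarrow> F (X - Y) = F X - F Y"
    using add[OF _ vfield_uminus, of X Y] minus[of Y] by simp
qed

lemma lie_bracket_add_left:
  "X \<in> V \<Longrightarrow> X' \<in> V \<Longrightarrow> Y \<in> V \<Longrightarrow> lie_bracket (X + X') Y = lie_bracket X Y + lie_bracket X' Y"
  by (simp add: lie_bracket_def in_vector_fieldsD(2) vfield_apply_smooth fun_eq_iff)

lemma lie_bracket_commute: "lie_bracket Y X = - lie_bracket X Y"
  by (simp add: lie_bracket_def fun_eq_iff)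

lemma lie_bracket_scale_left:
  "h \<in> C \<Longrightarrow> X \<in> V \<Longrightarrow> Y \<in> V \<Longrightarrow> lie_bracket (h \<odot> X) Y = h \<odot> lie_bracket X Y - Y h \<odot> X"
  by (simp add: lie_bracket_def vscale_def in_vector_fieldsD(4) vfield_apply_smooth fun_eq_iff
      algebra_simps)

lemma vfield_apply_diff: "X \<in> V \<Longrightarrow> f \<in> C \<Longrightarrow> h \<in> C \<Longrightarrow> X (f - h) = X f - X h"
  using in_vector_fieldsD(2)[of X "f - h" h] smooth_diff by (simp add: algebra_simps)

lemma jacobi:
  assumes "X \<in> V" "Y \<in> V" "Z \<in> V"
  shows "lie_bracket X (lie_bracket Y Z) + lie_bracket Y (lie_bracket Z X)
    + lie_bracket Z (lie_bracket X Y) = 0"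
  using assms by (simp add: lie_bracket_def vfield_apply_diff vfield_apply_smooth fun_eq_iff)

end

section \<open>Tensoriality and symmetries of the curvature of the Levi-Civita connection\<close>

locale levi_civita_manifold = riemannian_manifold A g
  for A :: "('m::t2_space, 'e::euclidean_space) chart set" and g +
  fixes nabla :: "'m connection"
  assumes connection: "levi_civita A g nabla"
begin

abbreviation "R \<equiv> curvature nabla"

lemma nabla_vfield: "X \<in> V \<Longrightarrow> Y \<in> V \<Longrightarrow> nabla X Y \<in> V"
  and nabla_add_left: "X \<in> V \<Longrightarrow> Y \<in> V \<Longrightarrow> Z \<in> V \<Longrightarrow> nabla (X + Y) Z = nabla X Z + nabla Y Z"
  and nabla_add: "X \<in> V \<Longrightarrow> Y \<in> V \<Longrightarrow> Z \<in> V \<Longrightarrow> nabla X (Y + Z) = nabla X Y + nabla X Z"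
  and nabla_scale_left: "h \<in> C \<Longrightarrow> X \<in> V \<Longrightarrow> Y \<in> V \<Longrightarrow> nabla (h \<odot> X) Y = h \<odot> nabla X Y"
  and nabla_scale: "h \<in> C \<Longrightarrow> X \<in> V \<Longrightarrow> Y \<in> V \<Longrightarrow> nabla X (h \<odot> Y) = X h \<odot> Y + h \<odot> nabla X Y"
  and torsion_free: "X \<in> V \<Longrightarrow> Y \<in> V \<Longrightarrow> lie_bracket X Y = nabla X Y - nabla Y X"
  and metric_compatible:
    "X \<in> V \<Longrightarrow> Y \<in> V \<Longrightarrow> Z \<in> V \<Longrightarrow> X (g Y Z) = g (nabla X Y) Z + g Y (nabla X Z)"
  using connection unfolding levi_civita_def affine_connection_def by auto

lemma nabla_minus_left: "X \<in> V \<Longrightarrow> Z \<in> V \<Longrightarrow> nabla (- X) Z = - nabla X Z"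
  and nabla_diff_left: "X \<in> V \<Longrightarrow> Y \<in> V \<Longrightarrow> Z \<in> V \<Longrightarrow> nabla (X - Y) Z = nabla X Z - nabla Y Z"
  using additive_on_vfields[of "\<lambda>X. nabla X Z"] nabla_add_left by auto

lemma nabla_diff: "X \<in> V \<Longrightarrow> Y \<in> V \<Longrightarrow> Z \<in> V \<Longrightarrow> nabla X (Y - Z) = nabla X Y - nabla X Z"
  using additive_on_vfields[of "nabla X"] nabla_add by auto

lemma metric_smooth: "X \<in> V \<Longrightarrow> Y \<in> V \<Longrightarrow> g X Y \<in> C"
  and metric_add: "X \<in> V \<Longrightarrow> Y \<in> V \<Longrightarrow> Z \<in> V \<Longrightarrow> g X (Y + Z) = g X Y + g X Z"
  and metric_scale: "h \<in> C \<Longrightarrow> X \<in> V \<Longrightarrow> Y \<in> V \<Longrightarrow> g X (h \<odot> Y) = h * g X Y"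
  using metric_one_form unfolding one_form_def by blast+

lemma metric_diff: "X \<in> V \<Longrightarrow> Y \<in> V \<Longrightarrow> Z \<in> V \<Longrightarrow> g X (Y - Z) = g X Y - g X Z"
  and metric_minus: "X \<in> V \<Longrightarrow> Y \<in> V \<Longrightarrow> g X (- Y) = - g X Y"
  using additive_on_vfields[of "g X"] metric_add by auto

lemma metric_add_left: "X \<in> V \<Longrightarrow> Y \<in> V \<Longrightarrow> Z \<in> V \<Longrightarrow> g (Y + Z) X = g Y X + g Z X"
  and metric_scale_left: "h \<in> C \<Longrightarrow> X \<in> V \<Longrightarrow> Y \<in> V \<Longrightarrow> g (h \<odot> Y) X = h * g Y X"
  and metric_diff_left: "X \<in> V \<Longrightarrow> Y \<in> V \<Longrightarrow> Z \<in> V \<Longrightarrow> g (Y - Z) X = g Y X - g Z X"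
  and metric_minus_left: "X \<in> V \<Longrightarrow> Y \<in> V \<Longrightarrow> g (- Y) X = - g Y X"
  by (simp_all add: metric_commute[of _ X] vfield_add vfield_scale vfield_diff vfield_uminus
      metric_add metric_scale metric_diff metric_minus)

lemmas metric_linear = metric_add metric_scale metric_diff metric_minus
  metric_add_left metric_scale_left metric_diff_left metric_minus_left

lemmas vfield_intros = vfield_add vfield_scale vfield_diff vfield_uminus vfield_zero nabla_vfield
  lie_bracket_in_vector_fields vfield_apply_smooth metric_smooth smooth_add smooth_diff smooth_mult

lemma curvature_vfield: "X \<in> V \<Longrightarrow> Y \<in> V \<Longrightarrow> Z \<in> V \<Longrightarrow> R X Y Z \<in> V"
  by (simp add: curvature_def vfield_intros)

lemma curvature_commute: "X \<in> V \<Longrightarrow> Y \<in> V \<Longrightarrow> Z \<in> V \<Longrightarrow> R Y X Z = - R X Y Z"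
  unfolding curvature_def lie_bracket_commute[of Y X]
  by (simp add: nabla_minus_left vfield_intros)

lemma curvature_add_1:
  "X \<in> V \<Longrightarrow> X' \<in> V \<Longrightarrow> Y \<in> V \<Longrightarrow> Z \<in> V \<Longrightarrow> R (X + X') Y Z = R X Y Z + R X' Y Z"
  by (simp add: curvature_def lie_bracket_add_left nabla_add_left nabla_add vfield_intros)

lemma curvature_scale_1:
  "h \<in> C \<Longrightarrow> X \<in> V \<Longrightarrow> Y \<in> V \<Longrightarrow> Z \<in> V \<Longrightarrow> R (h \<odot> X) Y Z = h \<odot> R X Y Z"
  by (simp add: curvature_def lie_bracket_scale_left nabla_scale_left nabla_diff_left nabla_scale
      vfield_intros)
    (simp add: vscale_def fun_eq_iff algebra_simps)

lemma curvature_add_2: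
  "X \<in> V \<Longrightarrow> X' \<in> V \<Longrightarrow> Y \<in> V \<Longrightarrow> Z \<in> V \<Longrightarrow> R Y (X + X') Z = R Y X Z + R Y X' Z"
  by (simp add: curvature_commute[of _ Y] curvature_add_1 vfield_add)

lemma curvature_scale_2:
  "h \<in> C \<Longrightarrow> X \<in> V \<Longrightarrow> Y \<in> V \<Longrightarrow> Z \<in> V \<Longrightarrow> R Y (h \<odot> X) Z = h \<odot> R Y X Z"
  by (simp add: curvature_commute[of _ Y] curvature_scale_1 vfield_scale)
    (simp add: vscale_def fun_eq_iff)

lemma curvature_add_3:
  "X \<in> V \<Longrightarrow> Y \<in> V \<Longrightarrow> Z \<in> V \<Longrightarrow> Z' \<in> V \<Longrightarrow> R X Y (Z + Z') = R X Y Z + R X Y Z'"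
  by (simp add: curvature_def nabla_add vfield_intros)

lemma curvature_scale_3:
  "h \<in> C \<Longrightarrow> X \<in> V \<Longrightarrow> Y \<in> V \<Longrightarrow> Z \<in> V \<Longrightarrow> R X Y (h \<odot> Z) = h \<odot> R X Y Z"
  by (simp add: curvature_def nabla_scale nabla_add vfield_intros)
    (simp add: vscale_def lie_bracket_def fun_eq_iff algebra_simps)

lemma curvature_endomorphism_1: "Y \<in> V \<Longrightarrow> Z \<in> V \<Longrightarrow> endomorphism_field A (\<lambda>X. R X Y Z)"
  and curvature_endomorphism_2: "X \<in> V \<Longrightarrow> Z \<in> V \<Longrightarrow> endomorphism_field A (\<lambda>Y. R X Y Z)"
  and curvature_endomorphism_3: "X \<in> V \<Longrightarrow> Y \<in> V \<Longrightarrow> endomorphism_field A (\<lambda>Z. R X Y Z)"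
  by (auto simp: endomorphism_field_def curvature_vfield curvature_add_1 curvature_scale_1
      curvature_add_2 curvature_scale_2 curvature_add_3 curvature_scale_3)

lemma bianchi:
  assumes "X \<in> V" "Y \<in> V" "Z \<in> V"
  shows "R X Y Z + R Y Z X + R Z X Y = 0"
proof -
  \<comment> \<open>These three terms come from three different curvature terms of the cyclic sum.
    Torsion freeness, used for \<open>Y\<close>, \<open>Z\<close> and then for \<open>X\<close> and
    their bracket, turns them into one iterated bracket, and the Jacobi identity finishes.\<close>
  have cyc: "nabla X (nabla Y Z) - nabla X (nabla Z Y) - nabla (lie_bracket Y Z) X
      = lie_bracket X (lie_bracket Y Z)"
    if "X \<in> V" "Y \<in> V" "Z \<in> V" for X Y Z
    using that torsion_free[of X "lie_bracket Y Z"]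
    by (simp add: torsion_free[of Y Z] nabla_diff vfield_intros)
  have "R X Y Z + R Y Z X + R Z X Y =
      lie_bracket X (lie_bracket Y Z) + lie_bracket Y (lie_bracket Z X) + lie_bracket Z (lie_bracket X Y)"
    using cyc[of X Y Z] cyc[of Y Z X] cyc[of Z X Y] assms
    by (simp add: curvature_def algebra_simps)
  then show ?thesis using jacobi assms by simp
qed

text \<open>The bracket acts on the function \<open>g Z W\<close> as a commutator of derivations.
  Expanding both sides by metric compatibility, the products of two first covariant derivatives
  cancel.\<close>

lemma curvature_skew:
  assumes X: "X \<in> V" and Y: "Y \<in> V" and Z: "Z \<in> V" and W: "W \<in> V"
  shows "g (R X Y Z) W = - g (R X Y W) Z"
proof -
  have XY: "X (Y (g Z W)) = g (nabla X (nabla Y Z)) W + g (nabla Y Z) (nabla X W)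
      + (g (nabla X Z) (nabla Y W) + g Z (nabla X (nabla Y W)))"
    if "X \<in> V" "Y \<in> V" for X Y
  proof -
    have "X (Y (g Z W)) = X (g (nabla Y Z) W) + X (g Z (nabla Y W))"
      unfolding metric_compatible[OF that(2) Z W]
      using that Z W by (intro in_vector_fieldsD(2)) (auto intro: vfield_intros)
    then show ?thesis
      using that Z W metric_compatible[of X "nabla Y Z" W] metric_compatible[of X Z "nabla Y W"]
      by (simp add: nabla_vfield)
  qed
  have "lie_bracket X Y (g Z W) = X (Y (g Z W)) - Y (X (g Z W))"
    by (simp add: lie_bracket_def)
  then have "g (R X Y Z) W + g Z (R X Y W) = 0"
    using XY[OF X Y] XY[OF Y X] metric_compatible[OF lie_bracket_in_vector_fields[OF X Y] Z W] X Y Z W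
    by (simp add: curvature_def metric_linear vfield_intros algebra_simps)
  then show ?thesis
    using metric_commute[OF Z curvature_vfield[OF X Y W]] by (simp add: eq_neg_iff_add_eq_0)
qed

lemma ricci_eq:
  assumes on: "orthonormal_frame_at A g p E" and "X \<in> V" "Y \<in> V"
  shows "ricci A nabla X Y p = (\<Sum>i\<in>Basis. g (E i) (R (E i) X Y) p)"
  unfolding ricci_def
  by (rule field_trace_eq[OF curvature_endomorphism_1 orthonormal_dual_frames[OF on]]) fact+

lemma scalar_curvature_eq:
  assumes on: "orthonormal_frame_at A g p E"
  shows "scalar_curvature A g nabla p = (\<Sum>j\<in>Basis. \<Sum>i\<in>Basis. g (E i) (R (E i) (E j) (E j)) p)"
proof -
  have E: "E i \<in> V" if "i \<in> Basis" for i using on that by (auto simp: orthonormal_frame_at_def)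
  have 1: "covector_at p (\<lambda>X. \<Sum>i\<in>Basis. g (E i) (R (E i) X Y) p)"
    and 2: "covector_at p (\<lambda>X. \<Sum>i\<in>Basis. g (E i) (R (E i) Y X) p)" if "Y \<in> V" for Y
    by (intro covector_at_sum_pointwise covector_at_endomorphism[OF curvature_endomorphism_2]
        covector_at_endomorphism[OF curvature_endomorphism_3] metric_covector E that; assumption)+
  \<comment> \<open>Linearity at \<open>p\<close> is transferred from the frame formula, whose
    summands are visibly linear, to the trace that defines \<open>ricci\<close>.\<close>
  have "covector_at p (\<lambda>X. ricci A nabla X Y p)" if "Y \<in> V" for Y
    by (rule covector_at_cong[OF ricci_eq[OF on _ that] 1[OF that]])
  moreover have "covector_at p (\<lambda>Y. ricci A nabla X Y p)" if "X \<in> V" for X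
    by (rule covector_at_cong[OF ricci_eq[OF on that] 2[OF that]])
  ultimately show ?thesis
    unfolding scalar_curvature_def using metric_trace_eq[OF _ _ on] by (simp add: ricci_eq[OF on] E)
qed

end

section \<open>How covariant derivatives and curvature interact with \<open>\<xi>\<close> and
  \<open>\<Phi>\<close>\<close>

locale kenmotsu_manifold = levi_civita_manifold A g nabla
  for A :: "('m::t2_space, 'e::euclidean_space) chart set" and g and nabla +
  fixes \<Phi> :: "'m vfield \<Rightarrow> 'm vfield" and \<xi> :: "'m vfield" and \<eta> :: "'m vfield \<Rightarrow> 'm \<Rightarrow> real"
  assumes kenmotsu: "kenmotsu A \<Phi> \<xi> \<eta> g nabla"
begin

lemma Phi_endomorphism: "endomorphism_field A \<Phi>"
  and xi_vfield: "\<xi> \<in> V" and eta_one_form: "one_form A \<eta>"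
  and Phi_Phi: "X \<in> V \<Longrightarrow> \<Phi> (\<Phi> X) = - X + \<eta> X \<odot> \<xi>"
  and eta_xi: "\<eta> \<xi> = 1"
  and Phi_skew: "X \<in> V \<Longrightarrow> Y \<in> V \<Longrightarrow> g X (\<Phi> Y) = - g (\<Phi> X) Y"
  and metric_xi: "X \<in> V \<Longrightarrow> g X \<xi> = \<eta> X"
  and nabla_xi: "X \<in> V \<Longrightarrow> nabla X \<xi> = X - \<eta> X \<odot> \<xi>"
  and nabla_Phi': "X \<in> V \<Longrightarrow> Y \<in> V \<Longrightarrow>
    nabla X (\<Phi> Y) - \<Phi> (nabla X Y) = - (g X (\<Phi> Y) \<odot> \<xi>) - \<eta> Y \<odot> \<Phi> X"
  using kenmotsu unfolding kenmotsu_def almost_contact_metric_def by blast+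

lemma nabla_Phi: "X \<in> V \<Longrightarrow> Y \<in> V \<Longrightarrow>
    nabla X (\<Phi> Y) = \<Phi> (nabla X Y) - g X (\<Phi> Y) \<odot> \<xi> - \<eta> Y \<odot> \<Phi> X"
  using nabla_Phi'[of X Y] by (simp add: algebra_simps)

lemma Phi_vfield: "X \<in> V \<Longrightarrow> \<Phi> X \<in> V"
  and Phi_add: "X \<in> V \<Longrightarrow> Y \<in> V \<Longrightarrow> \<Phi> (X + Y) = \<Phi> X + \<Phi> Y"
  and Phi_scale: "h \<in> C \<Longrightarrow> X \<in> V \<Longrightarrow> \<Phi> (h \<odot> X) = h \<odot> \<Phi> X"
  using Phi_endomorphism unfolding endomorphism_field_def by blast+

lemma Phi_diff: "X \<in> V \<Longrightarrow> Y \<in> V \<Longrightarrow> \<Phi> (X - Y) = \<Phi> X - \<Phi> Y"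
  using additive_on_vfields[of \<Phi>] Phi_add by auto

lemma eta_smooth: "X \<in> V \<Longrightarrow> \<eta> X \<in> C"
  and eta_add: "X \<in> V \<Longrightarrow> Y \<in> V \<Longrightarrow> \<eta> (X + Y) = \<eta> X + \<eta> Y"
  using eta_one_form unfolding one_form_def by blast+

lemma eta_diff: "X \<in> V \<Longrightarrow> Y \<in> V \<Longrightarrow> \<eta> (X - Y) = \<eta> X - \<eta> Y"
  using additive_on_vfields[of \<eta>] eta_add by auto

lemmas kenmotsu_intros = vfield_intros Phi_vfield xi_vfield eta_smooth

text \<open>Metric compatibility for \<open>\<eta> Z = g Z \<xi>\<close>. It supplies the
  derivatives of the coefficients \<open>\<eta>\<close> in second covariant derivatives.\<close>

lemma vfield_apply_eta:
  assumes "X \<in> V" "Z \<in> V"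
  shows "X (\<eta> Z) = \<eta> (nabla X Z) + g Z X - \<eta> X * \<eta> Z"
  using metric_compatible[of X Z \<xi>] assms
  by (simp add: metric_xi nabla_xi metric_linear kenmotsu_intros)

lemma curvature_xi:
  assumes X: "X \<in> V" and Y: "Y \<in> V"
  shows "R X Y \<xi> = \<eta> X \<odot> Y - \<eta> Y \<odot> X"
proof -
  have NN: "nabla X (nabla Y \<xi>) = nabla X Y - (X (\<eta> Y) \<odot> \<xi> + \<eta> Y \<odot> (X - \<eta> X \<odot> \<xi>))"
    if "X \<in> V" "Y \<in> V" for X Y
    using that by (simp add: nabla_xi nabla_diff nabla_scale kenmotsu_intros)
  have N: "nabla (lie_bracket X Y) \<xi> = nabla X Y - nabla Y X - (\<eta> (nabla X Y) - \<eta> (nabla Y X)) \<odot> \<xi>"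
    using X Y by (simp add: nabla_xi torsion_free eta_diff kenmotsu_intros)
  show ?thesis
    unfolding curvature_def NN[OF X Y] NN[OF Y X] N vfield_apply_eta[OF X Y] vfield_apply_eta[OF Y X]
    using metric_commute[OF X Y] by (simp add: vscale_def fun_eq_iff algebra_simps)
qed

text \<open>Expanded with a view to antisymmetrization. In the commutator the part symmetric in
  \<open>X\<close> and \<open>Y\<close> drops out, the terms with \<open>nabla X Y\<close> are
  absorbed by the bracket term, and of the remaining corrections to
  \<open>\<Phi> (nabla X (nabla Y Z))\<close> only those with coefficients
  \<open>g Y (\<Phi> Z)\<close> on \<open>X\<close> and \<open>g Z X\<close> on
  \<open>\<Phi> Y\<close> survive.\<close>

lemma nabla_nabla_Phi:
  assumes X: "X \<in> V" and Y: "Y \<in> V" and Z: "Z \<in> V"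
  shows "nabla X (nabla Y (\<Phi> Z)) = \<Phi> (nabla X (nabla Y Z))
    - g X (\<Phi> (nabla Y Z)) \<odot> \<xi> - \<eta> (nabla Y Z) \<odot> \<Phi> X
    - (g (nabla X Y) (\<Phi> Z) + g Y (\<Phi> (nabla X Z)) - g X (\<Phi> Z) * \<eta> Y - \<eta> Z * g Y (\<Phi> X)) \<odot> \<xi>
    - g Y (\<Phi> Z) \<odot> (X - \<eta> X \<odot> \<xi>)
    - (\<eta> (nabla X Z) + g Z X - \<eta> X * \<eta> Z) \<odot> \<Phi> Y
    - \<eta> Z \<odot> (\<Phi> (nabla X Y) - g X (\<Phi> Y) \<odot> \<xi> - \<eta> Y \<odot> \<Phi> X)"
proof -
  have "X (g Y (\<Phi> Z)) =
      g (nabla X Y) (\<Phi> Z) + g Y (\<Phi> (nabla X Z)) - g X (\<Phi> Z) * \<eta> Y - \<eta> Z * g Y (\<Phi> X)"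
    unfolding metric_compatible[OF X Y Phi_vfield[OF Z]] nabla_Phi[OF X Z]
    using X Y Z by (simp add: metric_linear metric_xi kenmotsu_intros algebra_simps)
  moreover have "nabla X (nabla Y (\<Phi> Z)) = nabla X (\<Phi> (nabla Y Z))
      - (X (g Y (\<Phi> Z)) \<odot> \<xi> + g Y (\<Phi> Z) \<odot> nabla X \<xi>) - (X (\<eta> Z) \<odot> \<Phi> Y + \<eta> Z \<odot> nabla X (\<Phi> Y))"
    unfolding nabla_Phi[OF Y Z] using X Y Z
    by (simp add: nabla_diff nabla_scale kenmotsu_intros)
  ultimately show ?thesis
    using X Y Z by (simp only: nabla_Phi nabla_xi vfield_apply_eta nabla_vfield)
      (simp add: vscale_def fun_eq_iff algebra_simps)
qed

text \<open>The four correction terms are precisely the failure of the hyperbolic curvature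
  \<open>g X Z \<odot> Y - g Y Z \<odot> X\<close> to commute with \<open>\<Phi>\<close>.
  Subtracting that tensor therefore leaves one that commutes.\<close>

lemma curvature_Phi:
  assumes X: "X \<in> V" and Y: "Y \<in> V" and Z: "Z \<in> V"
  shows "R X Y (\<Phi> Z) = \<Phi> (R X Y Z) + g Y Z \<odot> \<Phi> X - g X Z \<odot> \<Phi> Y
    + g X (\<Phi> Z) \<odot> Y - g Y (\<Phi> Z) \<odot> X"
proof -
  have br: "nabla (lie_bracket X Y) (\<Phi> Z) = \<Phi> (nabla (lie_bracket X Y) Z)
      - (g (nabla X Y) (\<Phi> Z) - g (nabla Y X) (\<Phi> Z)) \<odot> \<xi> - \<eta> Z \<odot> (\<Phi> (nabla X Y) - \<Phi> (nabla Y X))"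
    using X Y Z nabla_Phi[of "lie_bracket X Y" Z]
    by (simp add: torsion_free metric_linear Phi_diff kenmotsu_intros)
  have PR: "\<Phi> (R X Y Z) = \<Phi> (nabla X (nabla Y Z)) - \<Phi> (nabla Y (nabla X Z)) - \<Phi> (nabla (lie_bracket X Y) Z)"
    using X Y Z by (simp add: curvature_def Phi_diff kenmotsu_intros)
  have skew: "g Y (\<Phi> X) = - g X (\<Phi> Y)"
    using X Y Phi_skew[of Y X] metric_commute[of "\<Phi> Y" X] by (simp add: Phi_vfield)
  show ?thesis
    unfolding PR unfolding curvature_def br nabla_nabla_Phi[OF X Y Z] nabla_nabla_Phi[OF Y X Z] skew
      metric_commute[OF Z X] metric_commute[OF Z Y]
    by (simp add: vscale_def fun_eq_iff algebra_simps)
qed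

end

section \<open>The star-scalar curvature\<close>

context kenmotsu_manifold
begin

lemma star_ricci_eq:
  assumes on: "orthonormal_frame_at A g p E" and "X \<in> V" "Y \<in> V"
  shows "star_ricci A nabla \<Phi> X Y p = 1 / 2 * (\<Sum>i\<in>Basis. g (E i) (\<Phi> (R X (\<Phi> Y) (E i))) p)"
proof -
  have "endomorphism_field A (\<lambda>Z. \<Phi> (R X (\<Phi> Y) Z))"
    using assms by (simp add: endomorphism_field_def Phi_vfield Phi_add Phi_scale curvature_vfield
        curvature_add_3 curvature_scale_3)
  then show ?thesis
    unfolding star_ricci_def by (simp add: field_trace_eq[OF _ orthonormal_dual_frames[OF on]])
qed

lemma covector_at_star_ricci:
  assumes "Y \<in> V"
  shows "covector_at p (\<lambda>X. star_ricci A nabla \<Phi> X Y p)" "covector_at p (\<lambda>X. star_ricci A nabla \<Phi> Y X p)"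
proof -
  obtain E where on: "orthonormal_frame_at A g p E" using ex_orthonormal_frame by blast
  then have E: "E i \<in> V" if "i \<in> Basis" for i using that by (auto simp: orthonormal_frame_at_def)
  have 1: "covector_at p (\<lambda>X. g (E i) (\<Phi> (R X (\<Phi> Y) (E i))) p)" if "i \<in> Basis" for i
    using covector_at_endomorphism[OF curvature_endomorphism_1[OF Phi_vfield[OF assms] E[OF that]]
        covector_at_endomorphism[OF Phi_endomorphism metric_covector[OF E[OF that]]]] .
  have 2: "covector_at p (\<lambda>X. g (E i) (\<Phi> (R Y (\<Phi> X) (E i))) p)" if "i \<in> Basis" for i
    using covector_at_endomorphism[OF Phi_endomorphism
        covector_at_endomorphism[OF curvature_endomorphism_2[OF assms E[OF that]]
          covector_at_endomorphism[OF Phi_endomorphism metric_covector[OF E[OF that]]]]] .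
  show "covector_at p (\<lambda>X. star_ricci A nabla \<Phi> X Y p)"
    by (rule covector_at_cong[OF star_ricci_eq[OF on _ assms] covector_at_mult[OF covector_at_sum_pointwise[OF 1]]])
  show "covector_at p (\<lambda>X. star_ricci A nabla \<Phi> Y X p)"
    by (rule covector_at_cong[OF star_ricci_eq[OF on assms] covector_at_mult[OF covector_at_sum_pointwise[OF 2]]])
qed

lemma star_scalar_curvature_eq:
  assumes on: "orthonormal_frame_at A g p E"
  shows "star_scalar_curvature A g nabla \<Phi> p =
    - 1 / 2 * (\<Sum>j\<in>Basis. \<Sum>i\<in>Basis. g (R (E j) (\<Phi> (E j)) (E i)) (\<Phi> (E i)) p)"
proof -
  have E: "E i \<in> V" if "i \<in> Basis" for i using on that by (auto simp: orthonormal_frame_at_def)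
  have "g (E i) (\<Phi> (R (E j) (\<Phi> (E j)) (E i))) p = - g (R (E j) (\<Phi> (E j)) (E i)) (\<Phi> (E i)) p"
    if "i \<in> Basis" "j \<in> Basis" for i j
    using that Phi_skew[of "E i"] metric_commute[OF Phi_vfield[of "E i"]]
    by (simp add: E curvature_vfield Phi_vfield)
  then have "metric_trace A g (star_ricci A nabla \<Phi>) p =
      (\<Sum>j\<in>Basis. 1 / 2 * (\<Sum>i\<in>Basis. - g (R (E j) (\<Phi> (E j)) (E i)) (\<Phi> (E i)) p))"
    by (simp add: metric_trace_eq[where h = "star_ricci A nabla \<Phi>", OF covector_at_star_ricci on] star_ricci_eq[OF on] E)
  then show ?thesis
    by (simp add: star_scalar_curvature_def sum_negf sum_distrib_left)
qed

text \<open>The difference of \<open>R\<close> and the curvature tensor of hyperbolic space. It annihilates \<open>\<xi>\<close> and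
  commutes with \<open>\<Phi>\<close>, so that it behaves like the curvature of a Kaehler metric.\<close>

definition K :: "'m \<Rightarrow> 'm vfield \<Rightarrow> 'm vfield \<Rightarrow> 'm vfield \<Rightarrow> 'm vfield \<Rightarrow> real" where
  "K p X Y Z W = g (R X Y Z) W p - g X Z p * g Y W p + g Y Z p * g X W p"

lemma K_skew: "X \<in> V \<Longrightarrow> Y \<in> V \<Longrightarrow> Z \<in> V \<Longrightarrow> W \<in> V \<Longrightarrow> K p X Y Z W = - K p X Y W Z"
  by (simp add: K_def curvature_skew[of X Y Z W])

lemma K_bianchi:
  assumes "X \<in> V" "Y \<in> V" "Z \<in> V" "W \<in> V"
  shows "K p X Y Z W + K p Y Z X W + K p Z X Y W = 0"
proof -
  have "g (R X Y Z) W + g (R Y Z X) W + g (R Z X Y) W = g (R X Y Z + R Y Z X + R Z X Y) W"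
    using assms by (simp add: metric_add_left curvature_vfield vfield_add)
  also have "\<dots> = 0"
    using additive_on_vfields(1)[of "\<lambda>X. g X W"] assms by (simp add: bianchi metric_add_left)
  finally have "g (R X Y Z) W p + g (R Y Z X) W p + g (R Z X Y) W p = 0"
    by (simp add: fun_eq_iff)
  then show ?thesis
    using assms metric_commute by (simp add: K_def)
qed

text \<open>The corrections in \<open>curvature_Phi\<close> cancel against the hyperbolic part of
  \<open>K\<close>; skewness of \<open>\<Phi>\<close> then carries it to the last slot with a
  sign.\<close>

lemma K_Phi:
  assumes "X \<in> V" "Y \<in> V" "Z \<in> V" "W \<in> V"
  shows "K p X Y (\<Phi> Z) W = - K p X Y Z (\<Phi> W)"
  using assms
  by (simp add: K_def curvature_Phi metric_linear Phi_skew[of _ W] kenmotsu_intros curvature_vfield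
      algebra_simps)

lemma K_xi: "X \<in> V \<Longrightarrow> Y \<in> V \<Longrightarrow> W \<in> V \<Longrightarrow> K p X Y \<xi> W = 0"
  by (simp add: K_def curvature_xi metric_linear metric_xi kenmotsu_intros)

lemma K_xi': "X \<in> V \<Longrightarrow> Y \<in> V \<Longrightarrow> W \<in> V \<Longrightarrow> K p X Y W \<xi> = 0"
  using K_skew[of X Y W \<xi> p] K_xi xi_vfield by simp

lemma covector_at_K:
  assumes "X \<in> V" "Y \<in> V" "Z \<in> V"
  shows "covector_at p (\<lambda>W. K p W X Y Z)" "covector_at p (\<lambda>W. K p X Y Z W)"
proof -
  have "covector_at p (\<lambda>W. g (R W X Y) Z p - g X Z p * g W Y p + g X Y p * g W Z p)"
    using assms
    by (intro covector_at_add covector_at_diff covector_at_mult metric_covector_left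
        covector_at_endomorphism[OF curvature_endomorphism_1])
  then show "covector_at p (\<lambda>W. K p W X Y Z)"
    by (rule covector_at_cong[rotated]) (simp add: K_def)
  have "covector_at p (\<lambda>W. g (R X Y Z) W p - g X Z p * g Y W p + g Y Z p * g X W p)"
    using assms
    by (intro covector_at_add covector_at_diff covector_at_mult metric_covector curvature_vfield)
  then show "covector_at p (\<lambda>W. K p X Y Z W)" by (simp add: K_def)
qed

text \<open>On the orthogonal complement of \<open>\<xi>\<close> the map \<open>\<Phi>\<close> is an
  isometry, and it kills \<open>\<xi>\<close>, so the left side is the trace of \<open>B\<close>
  over that complement. The frame need not contain \<open>\<xi>\<close>: expanding one
  \<open>\<Phi> (E j)\<close> and using skewness moves both factors onto one slot, where
  \<open>\<Phi>\<close> squared is known.\<close>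

lemma sum_Phi_frame:
  assumes on: "orthonormal_frame_at A g p E"
    and B: "\<And>Y. Y \<in> V \<Longrightarrow> covector_at p (\<lambda>X. B X Y)" "\<And>X. X \<in> V \<Longrightarrow> covector_at p (B X)"
  shows "(\<Sum>j\<in>Basis. B (\<Phi> (E j)) (\<Phi> (E j))) = (\<Sum>j\<in>Basis. B (E j) (E j)) - B \<xi> \<xi>"
proof -
  have E: "E i \<in> V" if "i \<in> Basis" for i using on that by (auto simp: orthonormal_frame_at_def)
  have skew: "g (E k) (\<Phi> (E j)) p = - g (E j) (\<Phi> (E k)) p" if "j \<in> Basis" "k \<in> Basis" for j k
    using that Phi_skew[of "E k" "E j"] metric_commute[of "\<Phi> (E k)" "E j"] by (simp add: E Phi_vfield)
  have "(\<Sum>j\<in>Basis. B (\<Phi> (E j)) (\<Phi> (E j))) =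
      (\<Sum>j\<in>Basis. \<Sum>k\<in>Basis. g (E k) (\<Phi> (E j)) p * B (E k) (\<Phi> (E j)))"
    by (intro sum.cong refl orthonormal_expansion[OF on] B Phi_vfield E)
  also have "\<dots> = (\<Sum>k\<in>Basis. - (\<Sum>j\<in>Basis. g (E j) (\<Phi> (E k)) p * B (E k) (\<Phi> (E j))))"
    unfolding sum_negf[symmetric]
    by (subst sum.swap) (intro sum.cong refl, metis skew mult_minus_left)
  also have "\<dots> = (\<Sum>k\<in>Basis. - B (E k) (\<Phi> (\<Phi> (E k))))"
    by (intro sum.cong refl arg_cong[of _ _ uminus] orthonormal_expansion[OF on, symmetric]
        covector_at_endomorphism[OF Phi_endomorphism] B Phi_vfield E)
  also have "\<dots> = (\<Sum>k\<in>Basis. B (E k) (E k) - g (E k) \<xi> p * B (E k) \<xi>)"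
  proof (intro sum.cong refl)
    fix k :: 'e assume "k \<in> Basis"
    note Ek = E[OF this] and Bk = covector_atD[OF B(2)[OF E[OF this]]]
    show "- B (E k) (\<Phi> (\<Phi> (E k))) = B (E k) (E k) - g (E k) \<xi> p * B (E k) \<xi>"
      using additive_on_vfields(3)[of "B (E k)"] Bk Ek
      by (simp add: Phi_Phi metric_xi kenmotsu_intros)
  qed
  also have "\<dots> = (\<Sum>k\<in>Basis. B (E k) (E k)) - B \<xi> \<xi>"
    using orthonormal_expansion[OF on B(1)[OF xi_vfield] xi_vfield] by (simp add: sum_subtractf)
  finally show ?thesis .
qed

lemma star_scalar_curvature_eq_scalar_curvature:
  "star_scalar_curvature A g nabla \<Phi> p = scalar_curvature A g nabla p + (real DIM('e) - 1)\<^sup>2"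
proof -
  obtain E where on: "orthonormal_frame_at A g p E" using ex_orthonormal_frame by blast
  then have E: "E i \<in> V" and EE: "\<And>j. j \<in> Basis \<Longrightarrow> g (E i) (E j) p = (if i = j then 1 else 0)"
    if "i \<in> Basis" for i using that by (auto simp: orthonormal_frame_at_def)
  have \<Phi>E: "\<Phi> (E i) \<in> V" if "i \<in> Basis" for i using E[OF that] by (rule Phi_vfield)
  note in_V = E \<Phi>E xi_vfield
  let ?N = "real DIM('e)" and ?r = "scalar_curvature A g nabla p"
    and ?s = "star_scalar_curvature A g nabla \<Phi> p"
  define k where "k = (\<Sum>j\<in>Basis. \<Sum>i\<in>Basis. K p (E i) (E j) (E j) (E i))"

  \<comment> \<open>The total of the added terms is N(N - 1), the negative of the scalar curvature
    of hyperbolic N-space.\<close>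
  have "k = (\<Sum>j\<in>Basis. \<Sum>i\<in>Basis.
      g (E i) (R (E i) (E j) (E j)) p - (if i = j then 1 else 0) + 1)"
    unfolding k_def
  proof (intro sum.cong refl)
    fix i j :: 'e assume ij: "i \<in> Basis" "j \<in> Basis"
    show "K p (E i) (E j) (E j) (E i) =
        g (E i) (R (E i) (E j) (E j)) p - (if i = j then 1 else 0) + 1"
      using ij metric_commute[OF E[OF ij(1)], of "R (E i) (E j) (E j)"]
      by (simp add: K_def EE in_V curvature_vfield)
  qed
  then have r: "k = ?r - ?N + ?N * ?N"
    by (simp add: scalar_curvature_eq[OF on] sum.distrib sum_subtractf)

  have tr_Phi: "(\<Sum>j\<in>Basis. g (\<Phi> (E j)) (\<Phi> (E j)) p) = ?N - 1"
  proof -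
    have "(\<Sum>j\<in>Basis. g (\<Phi> (E j)) (\<Phi> (E j)) p) = (\<Sum>j\<in>Basis. g (E j) (E j) p) - g \<xi> \<xi> p"
      by (rule sum_Phi_frame[OF on metric_covector_left metric_covector])
    then show ?thesis by (simp add: EE metric_xi xi_vfield eta_xi)
  qed
  \<comment> \<open>Parseval's identity for \<open>\<Phi> (E j)\<close>.\<close>
  have Phi_norm: "(\<Sum>i\<in>Basis. g (E i) (\<Phi> (E j)) p * g (E i) (\<Phi> (E j)) p) = g (\<Phi> (E j)) (\<Phi> (E j)) p"
    if "j \<in> Basis" for j
    by (rule orthonormal_expansion[OF on metric_covector_left, symmetric]) (use in_V that in auto)
  \<comment> \<open>Each of the two hyperbolic terms sums to the squared length of
    \<open>\<Phi>\<close>, which is N - 1 by \<open>tr_Phi\<close>. The factor -2 in front of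
    \<open>?s\<close> inverts the -1/2 of \<open>star_scalar_curvature_eq\<close>.\<close>
  have "(\<Sum>j\<in>Basis. \<Sum>i\<in>Basis. K p (E j) (\<Phi> (E j)) (E i) (\<Phi> (E i))) =
      (\<Sum>j\<in>Basis. \<Sum>i\<in>Basis. g (R (E j) (\<Phi> (E j)) (E i)) (\<Phi> (E i)) p
        - (if j = i then g (\<Phi> (E j)) (\<Phi> (E j)) p else 0)
        - g (E i) (\<Phi> (E j)) p * g (E i) (\<Phi> (E j)) p)"
  proof (intro sum.cong refl)
    fix i j :: 'e assume ij: "i \<in> Basis" "j \<in> Basis"
    have "g (\<Phi> (E j)) (E i) p = g (E i) (\<Phi> (E j)) p" "g (E j) (\<Phi> (E i)) p = - g (E i) (\<Phi> (E j)) p"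
      using ij Phi_skew[of "E j" "E i"] metric_commute[of "\<Phi> (E j)" "E i"] by (simp_all add: in_V)
    then show "K p (E j) (\<Phi> (E j)) (E i) (\<Phi> (E i)) = g (R (E j) (\<Phi> (E j)) (E i)) (\<Phi> (E i)) p
        - (if j = i then g (\<Phi> (E j)) (\<Phi> (E j)) p else 0)
        - g (E i) (\<Phi> (E j)) p * g (E i) (\<Phi> (E j)) p"
      using ij by (simp add: K_def EE)
  qed
  also have "\<dots> = - 2 * ?s - 2 * (?N - 1)"
    by (simp add: star_scalar_curvature_eq[OF on] sum_subtractf Phi_norm)
      (simp add: tr_Phi flip: sum_distrib_left)
  finally have s: "(\<Sum>j\<in>Basis. \<Sum>i\<in>Basis. K p (E j) (\<Phi> (E j)) (E i) (\<Phi> (E i))) =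
    - 2 * ?s - 2 * (?N - 1)" .

  \<comment> \<open>The Bianchi identity on \<open>E j\<close>, \<open>\<Phi> (E j)\<close>,
    \<open>E i\<close>. In each of the other two cyclic terms \<open>\<Phi>\<close> can be moved
    within the last two slots until the first and last arguments agree and the middle ones
    agree.\<close>
  have "(\<Sum>j\<in>Basis. \<Sum>i\<in>Basis. K p (E j) (\<Phi> (E j)) (E i) (\<Phi> (E i))) =
      (\<Sum>j\<in>Basis. \<Sum>i\<in>Basis. - K p (\<Phi> (E j)) (E i) (E i) (\<Phi> (E j)) - K p (E i) (E j) (E j) (E i))"
  proof (intro sum.cong refl)
    fix i j :: 'e assume ij: "i \<in> Basis" "j \<in> Basis"
    have "K p (\<Phi> (E j)) (E i) (E j) (\<Phi> (E i)) = K p (\<Phi> (E j)) (E i) (E i) (\<Phi> (E j))"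
      using ij K_skew[of "\<Phi> (E j)" "E i" "E j" "\<Phi> (E i)" p] K_Phi[of "\<Phi> (E j)" "E i" "E i" "E j" p]
      by (simp add: in_V)
    moreover have "K p (E i) (E j) (\<Phi> (E j)) (\<Phi> (E i)) = K p (E i) (E j) (E j) (E i)"
    proof -
      \<comment> \<open>Moving \<open>\<Phi>\<close> across produces its square on
        \<open>E i\<close>; the part along \<open>\<xi>\<close> is annihilated by
        \<open>K\<close>.\<close>
      have "K p (E i) (E j) (\<Phi> (E j)) (\<Phi> (E i)) = - K p (E i) (E j) (E j) (- E i + \<eta> (E i) \<odot> \<xi>)"
        using ij K_Phi[of "E i" "E j" "E j" "\<Phi> (E i)" p] by (simp add: in_V Phi_Phi)
      also have "\<dots> = K p (E i) (E j) (E j) (E i)"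
        using ij covector_atD[OF covector_at_K(2)[of "E i" "E j" "E j" p]]
          additive_on_vfields(3)[of "K p (E i) (E j) (E j)"]
        by (simp add: in_V K_xi' vfield_uminus vfield_scale eta_smooth)
      finally show ?thesis .
    qed
    ultimately show "K p (E j) (\<Phi> (E j)) (E i) (\<Phi> (E i)) =
        - K p (\<Phi> (E j)) (E i) (E i) (\<Phi> (E j)) - K p (E i) (E j) (E j) (E i)"
      using ij K_bianchi[of "E j" "\<Phi> (E j)" "E i" "\<Phi> (E i)" p] by (simp add: in_V)
  qed
  also have "\<dots> = - (\<Sum>i\<in>Basis. \<Sum>j\<in>Basis. K p (\<Phi> (E j)) (E i) (E i) (\<Phi> (E j))) - k"
    unfolding k_def sum_subtractf sum_negf by (subst sum.swap) simp
  \<comment> \<open>For fixed \<open>i\<close>, replacing the frame by its image under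
    \<open>\<Phi>\<close> costs only a \<open>\<xi>\<close> term, which vanishes. Both Bianchi terms
    thus contribute \<open>k\<close>.\<close>
  also have "(\<Sum>i\<in>Basis. \<Sum>j\<in>Basis. K p (\<Phi> (E j)) (E i) (E i) (\<Phi> (E j))) =
      (\<Sum>i\<in>Basis. (\<Sum>j\<in>Basis. K p (E j) (E i) (E i) (E j)) - K p \<xi> (E i) (E i) \<xi>)"
    by (intro sum.cong refl sum_Phi_frame[OF on] covector_at_K E)
  also have "\<dots> = k" by (simp add: k_def K_xi' in_V)
  \<comment> \<open>Comparing -2k with \<open>s\<close> gives \<open>?s = k - (?N - 1)\<close>, and
    \<open>r\<close> turns this into \<open>?r + ?N * (?N - 1) - (?N - 1)\<close>.\<close>
  finally show ?thesis using r s by (simp add: power2_eq_square algebra_simps)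
qed

end

section \<open>Torse-forming solitons\<close>

lemma (in levi_civita_manifold) lie_derivative_torse_forming:
  assumes tf: "torse_forming A nabla \<rho> \<Psi> \<gamma>" and X: "X \<in> V" and Y: "Y \<in> V"
  shows "lie_derivative \<rho> g X Y p = 2 * \<Psi> p * g X Y p + \<gamma> X p * g \<rho> Y p + \<gamma> Y p * g \<rho> X p"
proof -
  have \<rho>: "\<rho> \<in> V" and \<Psi>: "\<Psi> \<in> C" using tf by (auto simp: torse_forming_def)
  have \<gamma>: "\<gamma> Z \<in> C" and nabla_rho: "nabla Z \<rho> = \<Psi> \<odot> Z + \<gamma> Z \<odot> \<rho>" if "Z \<in> V" for Z
    using tf that by (auto simp: torse_forming_def one_form_def)
  have "lie_derivative \<rho> g X Y = g (nabla X \<rho>) Y + g X (nabla Y \<rho>)"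
    unfolding lie_derivative_def metric_compatible[OF \<rho> X Y]
      torsion_free[OF \<rho> X] torsion_free[OF \<rho> Y]
    using X Y \<rho> by (simp add: metric_linear vfield_intros)
  then show ?thesis
    using X Y \<rho> \<Psi> \<gamma> metric_commute[OF X \<rho>]
    by (simp add: nabla_rho metric_linear vfield_intros)
qed

theorem theorem5p1:
  fixes A :: "('m::{t2_space, second_countable_topology}, 'e::euclidean_space) chart set"
    and \<Phi> :: "'m vfield \<Rightarrow> 'm vfield" and \<xi> :: "'m vfield" and \<eta> :: "'m vfield \<Rightarrow> 'm \<Rightarrow> real"
    and g :: "'m tensor2" and nabla :: "'m connection" and \<rho> :: "'m vfield"
    and \<Psi> :: "'m \<Rightarrow> real" and \<gamma> :: "'m vfield \<Rightarrow> 'm \<Rightarrow> real"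
    and \<Omega> \<omega> :: real and n :: nat
  assumes "smooth_atlas A" and "DIM('e) = 2 * n + 1"
    and "kenmotsu A \<Phi> \<xi> \<eta> g nabla"
    and "star_ricci_bourguignon_soliton A \<Phi> g nabla \<rho> \<Omega> \<omega>"
    and "torse_forming A nabla \<rho> \<Psi> \<gamma>"
  shows "\<forall>p. let r = scalar_curvature A g nabla p;
             e = (\<gamma> \<rho> p + r + 1) / (2 * real n + 1) + \<Psi> p + (2 * real n - 1)
                 - \<omega> * (r + 4 * (real n)\<^sup>2)
         in \<Omega> = e \<and> (compressing \<Omega> \<longleftrightarrow> e > 0) \<and> (balancing \<Omega> \<longleftrightarrow> e = 0) \<and> (enlarging \<Omega> \<longleftrightarrow> e < 0)"
proof
  fix p
  interpret kenmotsu_manifold A g nabla \<Phi> \<xi> \<eta>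
    using assms(1,3) by unfold_locales (auto simp: kenmotsu_def almost_contact_metric_def)
  define r where "r = scalar_curvature A g nabla p"
  define e where "e = (\<gamma> \<rho> p + r + 1) / (2 * real n + 1) + \<Psi> p + (2 * real n - 1)
    - \<omega> * (r + 4 * (real n)\<^sup>2)"
  let ?s = "star_scalar_curvature A g nabla \<Phi> p" and ?N = "2 * real n + 1"
  obtain E where on: "orthonormal_frame_at A g p E" using ex_orthonormal_frame by blast
  then have E: "E i \<in> V" "g (E i) (E i) p = 1" if "i \<in> Basis" for i
    using that by (auto simp: orthonormal_frame_at_def)
  have \<rho>: "\<rho> \<in> V" and \<gamma>: "one_form A \<gamma>" using assms(5) by (auto simp: torse_forming_def)
  have s: "?s = r + 4 * (real n)\<^sup>2"
    using assms(2) by (simp add: star_scalar_curvature_eq_scalar_curvature r_def power_mult_distrib)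
  \<comment> \<open>On the diagonal of an orthonormal frame the two \<open>\<gamma>\<close> terms of
    the Lie derivative coincide, hence the factor 2; their sum over the frame is the expansion of
    \<open>\<gamma> \<rho>\<close>.\<close>
  have "(\<Sum>i\<in>Basis. 2 * \<Psi> p + 2 * (g (E i) \<rho> p * \<gamma> (E i) p)
      + 2 * star_ricci A nabla \<Phi> (E i) (E i) p) = (\<Sum>i\<in>(Basis :: 'e set). 2 * (\<Omega> + \<omega> * ?s))"
  proof (intro sum.cong refl)
    fix i :: 'e assume i: "i \<in> Basis"
    have "lie_derivative \<rho> g (E i) (E i) p + 2 * star_ricci A nabla \<Phi> (E i) (E i) p =
        2 * (\<Omega> + \<omega> * ?s) * g (E i) (E i) p"
      using assms(4) E(1)[OF i] by (auto simp: star_ricci_bourguignon_soliton_def)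
    then show "2 * \<Psi> p + 2 * (g (E i) \<rho> p * \<gamma> (E i) p)
      + 2 * star_ricci A nabla \<Phi> (E i) (E i) p = 2 * (\<Omega> + \<omega> * ?s)"
      using E[OF i] metric_commute[OF \<rho> E(1)[OF i]]
      by (simp add: lie_derivative_torse_forming[OF assms(5)] mult.commute)
  qed
  moreover have "\<gamma> \<rho> p = (\<Sum>i\<in>Basis. g (E i) \<rho> p * \<gamma> (E i) p)"
    by (rule orthonormal_expansion[OF on covector_at_one_form[OF \<gamma>] \<rho>])
  moreover have "?s = (\<Sum>i\<in>Basis. star_ricci A nabla \<Phi> (E i) (E i) p)"
    unfolding star_scalar_curvature_def by (rule metric_trace_eq[where h = "star_ricci A nabla \<Phi>", OF covector_at_star_ricci on])
  ultimately have "?N * \<Psi> p + \<gamma> \<rho> p + ?s = ?N * (\<Omega> + \<omega> * ?s)"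
    using assms(2) by (simp add: sum.distrib flip: sum_distrib_left) (simp add: algebra_simps)
  then have "\<Omega> = \<Psi> p + (\<gamma> \<rho> p + ?s) / ?N - \<omega> * ?s"
    by (simp add: field_simps)
  \<comment> \<open>The splitting 4n^2 = 1 + (2n - 1)(2n + 1) explains both the summand 1 in the
    numerator and the separate term 2n - 1.\<close>
  also have "(\<gamma> \<rho> p + ?s) / ?N = (\<gamma> \<rho> p + r + 1) / ?N + (2 * real n - 1)"
    by (simp add: s field_simps power2_eq_square)
  finally have "\<Omega> = e" by (simp add: e_def s)
  then show "let r = scalar_curvature A g nabla p;
             e = (\<gamma> \<rho> p + r + 1) / (2 * real n + 1) + \<Psi> p + (2 * real n - 1)
                 - \<omega> * (r + 4 * (real n)\<^sup>2)
         in \<Omega> = e \<and> (compressing \<Omega> \<longleftrightarrow> e > 0) \<and> (balancing \<Omega> \<longleftrightarrow> e = 0) \<and> (enlarging \<Omega> \<longleftrightarrow> e < 0)"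
    by (simp add: Let_def e_def r_def compressing_def balancing_def enlarging_def)
qed

end
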